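(* For every integer $d\geq 0$, the $d$-th Laplacian polytope $P_{\partial(\sigma_{d+1})}$ of the boundary of the $(d+1)$-simplex has a regular unimodular triangulation.
   Context: Let $\sigma_{d+1}=2^{[d+2]}$ be the full simplex on vertex set $[d+2]=\{1<2<\dots<d+2\}$ and $\partial(\sigma_{d+1})=\sigma_{d+1}\setminus\{[d+2]\}$ its boundary, a $d$-dimensional simplicial complex. For a simplicial complex $\Delta$ on an ordered vertex set, $C_i(\Delta)$ is the $\mathbb{Q}$-vector space with basis $e_\sigma$, $\sigma$ an $i$-dimensional face, with $C_i(\Delta)=0$ for $i\le -1$ and $i>\dim\Delta$; the boundary map $\partial_i:C_i(\Delta)\to C_{i-1}(\Delta)$ is $\partial_i(e_\sigma)=\sum_{k=1}^{i+1}(-1)^{k-1}e_{\sigma\setminus\{j_k\}}$ for $\sigma=\{j_1<\dots<j_{i+1}\}$ (so $\partial_0=0$). The $i$-th Laplacian matrix is $\mathcal{L}_i(\Delta)=\partial_{i+1}\partial_{i+1}^{\top}+\partial_i^{\top}\partial_i$. For $\Delta=\partial(\sigma_{d+1})$ the rows and columns of $\mathcal{L}_d(\Delta)\in\mathbb{Z}^{(d+2)\times(d+2)}$ are ordered according to the facets $F_1,\dots,F_{d+2}$, where $F_i=[d+2]\setminus\{d+3-i\}$. Then $P_{\partial(\sigma_{d+1})}\subseteq\mathbb{R}^{d+2}$ is the convex hull of the columns of $\mathcal{L}_d(\partial(\sigma_{d+1}))$. A triangulation $\mathcal{T}$ of a lattice polytope $P$ is a subdivision into lattice simplices. It is unimodular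 if each full-dimensional simplex has normalized volume $1$ with respect to the lattice $\mathrm{aff}(P)\cap\mathbb{Z}^{d+2}$ (i.e. its vertices form an affine lattice basis of $\mathrm{aff}(P)\cap\mathbb{Z}^{d+2}$). It is regular if there is a height function $\omega$ from the vertex set of $\mathcal{T}$ to $\mathbb{R}$ such that $\mathcal{T}$ is the projection of the lower envelope of $\mathrm{conv}\{(v,\omega(v))\}$. *)

theory Defs
  imports "HOL-Analysis.Analysis"
begin

definition full_simplex :: "nat \<Rightarrow> nat set set" where
  "full_simplex n = Pow {1..n}"

(* The boundary of the (d+1)-dimensional simplex, which has d + 2 vertices. *)
definition boundary_simplex :: "nat \<Rightarrow> nat set set" where
  "boundary_simplex d = full_simplex (d + 2) - {{1..d + 2}}"

(* The dimension is an integer, and the chain complex is not augmented: the empty face is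
   not a face of dimension -1, so that C_i = 0 for all i <= -1. *)
definition faces :: "nat set set \<Rightarrow> int \<Rightarrow> nat set set" where
  "faces \<Delta> i = {\<sigma> \<in> \<Delta>. 0 \<le> i \<and> finite \<sigma> \<and> int (card \<sigma>) = i + 1}"

(* Chains are represented by their coordinate functions with respect to the basis of faces. *)
type_synonym chain = "nat set \<Rightarrow> rat"

definition basis_chain :: "nat set \<Rightarrow> chain" where
  "basis_chain \<sigma> = (\<lambda>\<tau>. if \<tau> = \<sigma> then 1 else 0)"

(* j_k for \<sigma> = {j_1 < j_2 < ...}; the index k starts at 1. *)
definition nth_vertex :: "nat set \<Rightarrow> nat \<Rightarrow> nat" where
  "nth_vertex \<sigma> k = sorted_list_of_set \<sigma> ! (k - 1)"

(* Linear extension of  e_\<sigma> |-> \<Sum>k. (-1)^(k-1) e_{\<sigma> - {j_k}}  from C_i to C_{i-1}.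
   The case distinction makes the map vanish when C_{i-1} = 0, in particular for i = 0. *)
definition boundary_map :: "nat set set \<Rightarrow> int \<Rightarrow> chain \<Rightarrow> chain" where
  "boundary_map \<Delta> i c = (\<lambda>\<tau>.
     if \<tau> \<in> faces \<Delta> (i - 1)
     then (\<Sum>\<sigma>\<in>faces \<Delta> i. c \<sigma> *
             (\<Sum>k=1..card \<sigma>. (-1) ^ (k - 1) * basis_chain (\<sigma> - {nth_vertex \<sigma> k}) \<tau>))
     else 0)"

definition boundary_matrix :: "nat set set \<Rightarrow> int \<Rightarrow> nat set \<Rightarrow> nat set \<Rightarrow> rat" where
  "boundary_matrix \<Delta> i \<tau> \<sigma> = boundary_map \<Delta> i (basis_chain \<sigma>) \<tau>"

definition laplacian :: "nat set set \<Rightarrow> int \<Rightarrow> nat set \<Rightarrow> nat set \<Rightarrow> rat" where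
  "laplacian \<Delta> i \<sigma> \<sigma>' =
     (\<Sum>\<rho>\<in>faces \<Delta> (i + 1). boundary_matrix \<Delta> (i + 1) \<sigma> \<rho> * boundary_matrix \<Delta> (i + 1) \<sigma>' \<rho>)
   + (\<Sum>\<tau>\<in>faces \<Delta> (i - 1). boundary_matrix \<Delta> i \<tau> \<sigma> * boundary_matrix \<Delta> i \<tau> \<sigma>')"

definition ordered_facet :: "nat \<Rightarrow> nat \<Rightarrow> nat set" where
  "ordered_facet d i = {1..d + 2} - {d + 3 - i}"

(* The finite index type of the coordinates is identified with {1..d+2} by means of idx. *)
definition laplacian_matrix :: "('n::finite \<Rightarrow> nat) \<Rightarrow> nat \<Rightarrow> real ^ 'n ^ 'n" where
  "laplacian_matrix idx d =
     (\<chi> i j. of_rat (laplacian (boundary_simplex d) (int d)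
                        (ordered_facet d (idx i)) (ordered_facet d (idx j))))"

definition laplacian_polytope :: "('n::finite \<Rightarrow> nat) \<Rightarrow> nat \<Rightarrow> (real ^ 'n) set" where
  "laplacian_polytope idx d = convex hull (columns (laplacian_matrix idx d))"

definition integer_points :: "(real ^ 'n) set" where
  "integer_points = {x. \<forall>i. x $ i \<in> \<int>}"

definition polytope_vertices :: "(real ^ 'n) set \<Rightarrow> (real ^ 'n) set" where
  "polytope_vertices T = {v. v extreme_point_of T}"

definition vertex_set :: "(real ^ 'n) set set \<Rightarrow> (real ^ 'n) set" where
  "vertex_set \<T> = (\<Union>T\<in>\<T>. polytope_vertices T)"

(* The members of \<T> are the (closed) simplices of all dimensions, including the empty one. *)
definition lattice_triangulation :: "(real ^ 'n::finite) set set \<Rightarrow> (real ^ 'n) set \<Rightarrow> bool" where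
  "lattice_triangulation \<T> P \<longleftrightarrow>
     simplicial_complex \<T> \<and> \<Union>\<T> = P \<and> vertex_set \<T> \<subseteq> integer_points"

definition affine_lattice_basis :: "(real ^ 'n::finite) set \<Rightarrow> (real ^ 'n) set \<Rightarrow> bool" where
  "affine_lattice_basis V L \<longleftrightarrow>
     finite V \<and> \<not> affine_dependent V \<and>
     L = {\<Sum>v\<in>V. c v *\<^sub>R v | c. (\<forall>v\<in>V. c v \<in> \<int>) \<and> sum c V = 1}"

definition unimodular :: "(real ^ 'n::finite) set set \<Rightarrow> (real ^ 'n) set \<Rightarrow> bool" where
  "unimodular \<T> P \<longleftrightarrow>
     (\<forall>T\<in>\<T>. aff_dim T = aff_dim P \<longrightarrow>
        affine_lattice_basis (polytope_vertices T) (affine hull P \<inter> integer_points))"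

definition lifted_polytope ::
  "(real ^ 'n::finite) set set \<Rightarrow> (real ^ 'n \<Rightarrow> real) \<Rightarrow> ((real ^ 'n) \<times> real) set" where
  "lifted_polytope \<T> \<omega> = convex hull ((\<lambda>v. (v, \<omega> v)) ` vertex_set \<T>)"

definition lower_envelope :: "((real ^ 'n) \<times> real) set \<Rightarrow> ((real ^ 'n) \<times> real) set" where
  "lower_envelope Q = {(x, t). (x, t) \<in> Q \<and> (\<forall>s. (x, s) \<in> Q \<longrightarrow> t \<le> s)}"

definition lower_faces :: "((real ^ 'n::finite) \<times> real) set \<Rightarrow> ((real ^ 'n) \<times> real) set set" where
  "lower_faces Q = {F. F face_of Q \<and> F \<subseteq> lower_envelope Q}"

definition regular :: "(real ^ 'n::finite) set set \<Rightarrow> bool" where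
  "regular \<T> \<longleftrightarrow> (\<exists>\<omega>. \<T> = (\<lambda>F. fst ` F) ` lower_faces (lifted_polytope \<T> \<omega>))"

end

theory Submission
  imports Defs
begin

text \<open>Put n = d + 2 and let s be the alternating sign vector. For d > 0 the columns of the Laplacian
  are n e_j - s_j s, and for d = 0 the polytope is a point. Splitting the coordinates by the sign of
  s_j, the columns span two dilated standard simplices. If n is odd, all lattice points lie on these
  two simplices and the polytope is their join. If n is even, the polytope is the translate by the
  all-ones vector of 2Q, where Q is spanned by two simplices, dilated by n/2, that share a relative
  interior lattice point.

  A dilated simplex gets its unimodular alcove triangulation from a discretely convex quadratic
  form in the partial sums of the coordinates; joins only need these heights side by side; and a
  unimodular triangulation of Q is refined to one of 2Q by sorting pairs of vertices. In
  each case the height is integral, and the cells are the contact sets of affine minorants. No tuple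
  of points of a contact set can be exchanged for a cheaper tuple with the same sum, and this
  combinatorial condition alone forces the contact set to be part of a lattice basis.\<close>

section \<open>Regular subdivisions as contact complexes\<close>

text \<open>Exchanges are used in place of contact sets because of the doubling: the summands that
  occur in a contact set of the doubled configuration come with no evident affine minorant, but if
  each summand keeps its partner, an exchange of summands becomes an exchange of points of the
  contact set. The length bound \<open>N\<close> has to be carried along: the reward for the rank
  distance is absorbed by a constant that grows with \<open>N\<close>, while for even n the argument
  exchanges at once all points of a contact set that lie in one simplex only, so pairs do not
  suffice. The parity of n decides how a coefficient sum is split between the two simplices. For odd
  n a coordinate sum tells them apart, with values at distance one. For even n they share a point,
  so a functional that is constant on each of them takes the same value on both, and the height has
  to do the separation.\<close>

lemma convex_hull_Int_supporting_hyperplane: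
  fixes S :: "'a::euclidean_space set"
  assumes "finite S" and le: "\<And>s. s \<in> S \<Longrightarrow> a \<bullet> s \<le> b"
  shows "convex hull S \<inter> {x. a \<bullet> x = b} = convex hull (S \<inter> {x. a \<bullet> x = b})" (is "?L = convex hull ?T")
proof (intro antisym subsetI)
  fix x assume x: "x \<in> ?L"
  then obtain u where u: "\<And>s. s \<in> S \<Longrightarrow> 0 \<le> u s" "sum u S = 1" "(\<Sum>s\<in>S. u s *\<^sub>R s) = x"
    using assms(1) by (auto simp: convex_hull_finite)
  \<comment> \<open>The weighted slack of a point on the hyperplane is zero and has nonnegative
    terms, so no weight sits off the hyperplane.\<close>
  have "(\<Sum>s\<in>S. u s * (b - a \<bullet> s)) = b * sum u S - a \<bullet> (\<Sum>s\<in>S. u s *\<^sub>R s)"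
    by (simp add: inner_sum_right right_diff_distrib sum_subtractf sum_distrib_left mult.commute)
  also have "\<dots> = 0"
    using x u by auto
  finally have "\<forall>s\<in>S. u s * (b - a \<bullet> s) = 0"
    using u(1) le assms(1) by (subst (asm) sum_nonneg_eq_0_iff) (auto intro!: mult_nonneg_nonneg)
  then have z: "u s = 0" if "s \<in> S - ?T" for s
    using that by auto
  have "sum u ?T = sum u S" "(\<Sum>s\<in>?T. u s *\<^sub>R s) = (\<Sum>s\<in>S. u s *\<^sub>R s)"
    using z assms(1) by (intro sum.mono_neutral_left; auto)+
  then have "sum u ?T = 1" "(\<Sum>s\<in>?T. u s *\<^sub>R s) = x"
    using u(2,3) by simp_all
  then show "x \<in> convex hull ?T"
    using u(1) assms(1) by (auto simp: convex_hull_finite)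
next
  fix x assume x: "x \<in> convex hull ?T"
  have "convex hull ?T \<subseteq> {x. a \<bullet> x = b}"
    by (rule hull_minimal) (auto simp: convex_hyperplane)
  then show "x \<in> ?L"
    using x hull_mono[of ?T S convex] by auto
qed

section \<open>Affine minorants, contact sets and the lifted hull\<close>

definition minorant :: "'a::euclidean_space set \<Rightarrow> ('a \<Rightarrow> real) \<Rightarrow> 'a \<Rightarrow> real \<Rightarrow> bool" where
  "minorant A \<omega> a c \<longleftrightarrow> (\<forall>x\<in>A. a \<bullet> x + c \<le> \<omega> x)"

definition contact :: "'a::euclidean_space set \<Rightarrow> ('a \<Rightarrow> real) \<Rightarrow> 'a \<Rightarrow> real \<Rightarrow> 'a set" where
  "contact A \<omega> a c = {x\<in>A. a \<bullet> x + c = \<omega> x}"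

definition contact_complex :: "'a::euclidean_space set \<Rightarrow> ('a \<Rightarrow> real) \<Rightarrow> 'a set set" where
  "contact_complex A \<omega> = {convex hull (contact A \<omega> a c) | a c. minorant A \<omega> a c}"

abbreviation lift :: "('a \<Rightarrow> real) \<Rightarrow> 'a \<Rightarrow> 'a \<times> real" where
  "lift \<omega> x \<equiv> (x, \<omega> x)"

lemma contact_subset: "contact A \<omega> a c \<subseteq> A"
  by (auto simp: contact_def)

lemma finite_contact: "finite A \<Longrightarrow> finite (contact A \<omega> a c)"
  by (rule finite_subset[OF contact_subset])

lemma convex_hull_affine_graph:
  fixes S :: "'a::euclidean_space set"
  shows "convex hull ((\<lambda>x. (x, a \<bullet> x + c)) ` S) = (\<lambda>x. (x, a \<bullet> x + c)) ` (convex hull S)"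
proof -
  have lin: "linear (\<lambda>x. (x, a \<bullet> x))"
    by (intro linearI) (auto simp: inner_add_right)
  have eq: "(\<lambda>x. (x, a \<bullet> x + c)) ` T = (\<lambda>z. (0, c) + z) ` (\<lambda>x. (x, a \<bullet> x)) ` T" for T
    by (auto simp: image_image add.commute)
  show ?thesis
    unfolding eq convex_hull_translation convex_hull_linear_image[OF lin] ..
qed

lemma lifted_hull_above_minorant:
  assumes "minorant A \<omega> a c" "B \<subseteq> A" "(x, t) \<in> convex hull (lift \<omega> ` B)"
  shows "a \<bullet> x + c \<le> t"
proof -
  have "convex hull (lift \<omega> ` B) \<subseteq> {z. (a, - 1) \<bullet> z \<le> - c}"
    using assms(1,2)
    by (intro hull_minimal convex_halfspace_le) (fastforce simp: minorant_def)
  then show ?thesis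
    using assms(3) by (auto simp: inner_prod_def)
qed

text \<open>\<open>B\<close> may be any set between the contact set and \<open>A\<close>, because
  \<open>regular\<close> lifts only the vertices of the triangulation, and these can be a proper
  subset of \<open>A\<close>.\<close>

lemma lifted_hull_Int_hyperplane:
  assumes "finite A" "minorant A \<omega> a c" "contact A \<omega> a c \<subseteq> B" "B \<subseteq> A"
  shows "convex hull (lift \<omega> ` B) \<inter> {z. (a, - 1) \<bullet> z = - c}
       = (\<lambda>x. (x, a \<bullet> x + c)) ` (convex hull (contact A \<omega> a c))"
proof -
  have "convex hull (lift \<omega> ` B) \<inter> {z. (a, - 1) \<bullet> z = - c}
      = convex hull (lift \<omega> ` B \<inter> {z. (a, - 1) \<bullet> z = - c})"
  proof (rule convex_hull_Int_supporting_hyperplane)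
    show "finite (lift \<omega> ` B)"
      using assms(1,4) by (blast intro: finite_subset)
    show "(a, - 1) \<bullet> z \<le> - c" if "z \<in> lift \<omega> ` B" for z
      using that assms(2,4) by (fastforce simp: minorant_def)
  qed
  also have "lift \<omega> ` B \<inter> {z. (a, - 1) \<bullet> z = - c} = (\<lambda>x. (x, a \<bullet> x + c)) ` contact A \<omega> a c"
    using assms(3,4) by (force simp: contact_def inner_prod_def)
  finally show ?thesis
    by (simp add: convex_hull_affine_graph)
qed

text \<open>Take the lowest point over \<open>x\<close> in the lifted polytope. Among its finitely
  many half-spaces, one is violated by points arbitrarily close below. That half-space is not
  vertical (\<open>k < 0\<close>) and is tight at the lowest point; solved for the height, it is the
  minorant.\<close>

lemma minorant_touching:
  fixes A :: "'a::euclidean_space set"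
  assumes "finite A" "x \<in> convex hull A"
  obtains a c where "minorant A \<omega> a c" "x \<in> convex hull (contact A \<omega> a c)"
proof -
  define Q where "Q = convex hull (lift \<omega> ` A)"
  have "fst ` Q = convex hull (fst ` lift \<omega> ` A)"
    unfolding Q_def by (rule convex_hull_linear_image) (rule linear_fst)
  then have "x \<in> fst ` Q"
    using assms(2) by (simp add: image_image)
  moreover have "compact Q"
    unfolding Q_def using assms(1) by (simp add: compact_convex_hull finite_imp_compact)
  ultimately have "compact (Q \<inter> {x} \<times> UNIV)" "Q \<inter> {x} \<times> UNIV \<noteq> {}"
    by (auto intro!: compact_Int_closed closed_Times)
  then obtain z where z: "z \<in> Q \<inter> {x} \<times> UNIV" "\<forall>y\<in>Q \<inter> {x} \<times> UNIV. snd z \<le> snd y"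
    using continuous_attains_inf[OF _ _ continuous_on_snd[OF continuous_on_id]] by metis
  then obtain t where t: "(x, t) \<in> Q" "\<And>s. (x, s) \<in> Q \<Longrightarrow> t \<le> s"
    by (cases z) force
  have "polyhedron Q"
    unfolding Q_def using assms(1) by (simp add: polytope_convex_hull polytope_imp_polyhedron)
  then obtain F where F: "finite F" "Q = \<Inter>F" "\<And>h. h \<in> F \<Longrightarrow> \<exists>a b. h = {x. a \<bullet> x \<le> b}"
    unfolding polyhedron_def by metis
  have "\<exists>h\<in>F. \<not> (\<forall>\<^sub>F e in at_right 0. (x, t - e) \<in> h)"
  proof (rule ccontr)
    assume "\<not> ?thesis"
    then have "\<forall>\<^sub>F e in at_right (0::real). \<forall>h\<in>F. (x, t - e) \<in> h"
      using F(1) by (auto intro: eventually_ball_finite)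
    moreover have "\<forall>\<^sub>F e in at_right (0::real). e > 0"
      by (simp add: eventually_at_right_less)
    ultimately have "\<forall>\<^sub>F e in at_right (0::real). False"
      by eventually_elim (use t(2) F(2) in force)
    then show False
      by simp
  qed
  then obtain h where h: "h \<in> F" "\<not> (\<forall>\<^sub>F e in at_right 0. (x, t - e) \<in> h)"
    by blast
  then obtain p \<beta> where p: "h = {z. p \<bullet> z \<le> \<beta>}"
    using F(3) by meson
  obtain a k where ak: "p = (a, k)"
    by (cases p)
  have hle: "a \<bullet> y + k * s \<le> \<beta>" if "(y, s) \<in> Q" for y s
    using that h(1) F(2) p ak by auto
  have "k < 0"
  proof (rule ccontr)
    assume "\<not> k < 0"
    have "(x, t - e) \<in> h" if "e > 0" for e
    proof -
      have "k * (t - e) \<le> k * t"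
        using that \<open>\<not> k < 0\<close> by (intro mult_left_mono) auto
      then show ?thesis
        using hle[OF t(1)] by (simp add: p ak)
    qed
    then have "\<forall>\<^sub>F e in at_right 0. (x, t - e) \<in> h"
      by (rule eventually_mono[OF eventually_at_right_less])
    then show False
      using h(2) by simp
  qed
  have "a \<bullet> x + k * t = \<beta>"
  proof (rule ccontr)
    assume "a \<bullet> x + k * t \<noteq> \<beta>"
    then have pos: "(a \<bullet> x + k * t - \<beta>) / k > 0"
      using hle[OF t(1)] \<open>k < 0\<close> by (simp add: divide_neg_neg)
    have "(x, t - e) \<in> h" if "e < (a \<bullet> x + k * t - \<beta>) / k" for e
      using that \<open>k < 0\<close> by (simp add: p ak field_simps)
    then have "\<forall>\<^sub>F e in at_right 0. (x, t - e) \<in> h"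
      using pos unfolding eventually_at_right_field by blast
    then show False
      using h(2) by simp
  qed
  define a' where "a' = (- 1 / k) *\<^sub>R a"
  define c' where "c' = \<beta> / k"
  have "minorant A \<omega> a' c'"
    unfolding minorant_def
  proof
    fix y assume "y \<in> A"
    then have "a \<bullet> y + k * \<omega> y \<le> \<beta>"
      by (intro hle) (auto simp: Q_def hull_inc)
    then show "a' \<bullet> y + c' \<le> \<omega> y"
      using \<open>k < 0\<close> by (simp add: a'_def c'_def field_simps)
  qed
  moreover have "x \<in> convex hull (contact A \<omega> a' c')"
  proof -
    have "a' \<bullet> x + c' = t"
      using \<open>a \<bullet> x + k * t = \<beta>\<close> \<open>k < 0\<close> by (simp add: a'_def c'_def field_simps)
    then have "(x, t) \<in> convex hull (lift \<omega> ` A) \<inter> {z. (a', - 1) \<bullet> z = - c'}"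
      using t(1) by (simp add: Q_def)
    also have "\<dots> = (\<lambda>x. (x, a' \<bullet> x + c')) ` (convex hull (contact A \<omega> a' c'))"
      using calculation \<open>minorant A \<omega> a' c'\<close> assms(1)
      by (intro lifted_hull_Int_hyperplane contact_subset) auto
    finally show ?thesis
      by auto
  qed
  ultimately show thesis
    using that by blast
qed

lemma Union_contact_complex:
  assumes "finite A"
  shows "\<Union>(contact_complex A \<omega>) = convex hull A"
proof
  show "\<Union>(contact_complex A \<omega>) \<subseteq> convex hull A"
    by (auto simp: contact_complex_def dest: hull_mono[OF contact_subset, THEN subsetD])
  show "convex hull A \<subseteq> \<Union>(contact_complex A \<omega>)"
  proof
    fix x assume "x \<in> convex hull A"
    then obtain a c where "minorant A \<omega> a c" "x \<in> convex hull (contact A \<omega> a c)"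
      using minorant_touching[OF assms] by metis
    then show "x \<in> \<Union>(contact_complex A \<omega>)"
      by (auto simp: contact_complex_def)
  qed
qed

text \<open>Tilting the minorant by a small multiple of the functional that exposes the face.\<close>

lemma exposed_in_contact_complex:
  fixes A :: "'a::euclidean_space set"
  assumes "finite A" "minorant A \<omega> a c"
    and le: "\<And>x. x \<in> contact A \<omega> a c \<Longrightarrow> h \<bullet> x \<le> b"
  shows "convex hull (contact A \<omega> a c) \<inter> {x. h \<bullet> x = b} \<in> contact_complex A \<omega>"
proof -
  let ?M = "contact A \<omega> a c"
  have "\<forall>\<^sub>F e in at_right 0. \<forall>x\<in>A. a \<bullet> x + c + e * (h \<bullet> x - b) \<le> \<omega> x \<and>
      (a \<bullet> x + c + e * (h \<bullet> x - b) = \<omega> x \<longrightarrow> x \<in> ?M \<and> h \<bullet> x = b)"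
  proof (intro eventually_ball_finite assms(1) ballI)
    fix x assume x: "x \<in> A"
    have pos: "\<forall>\<^sub>F e in at_right (0::real). e > 0"
      by (simp add: eventually_at_right_less)
    show "\<forall>\<^sub>F e in at_right 0. a \<bullet> x + c + e * (h \<bullet> x - b) \<le> \<omega> x \<and>
      (a \<bullet> x + c + e * (h \<bullet> x - b) = \<omega> x \<longrightarrow> x \<in> ?M \<and> h \<bullet> x = b)"
    proof (cases "x \<in> ?M")
      case True
      then have "a \<bullet> x + c = \<omega> x" "h \<bullet> x \<le> b"
        using le by (auto simp: contact_def)
      with True show ?thesis
        by (intro eventually_mono[OF pos]) (auto simp: mult_le_0_iff)
    next
      case False
      then have "a \<bullet> x + c < \<omega> x"
        using assms(2) x by (force simp: minorant_def contact_def)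
      moreover have "((\<lambda>e. a \<bullet> x + c + e * (h \<bullet> x - b)) \<longlongrightarrow> a \<bullet> x + c + 0 * (h \<bullet> x - b)) (at_right 0)"
        by (intro tendsto_intros)
      ultimately have "\<forall>\<^sub>F e in at_right 0. a \<bullet> x + c + e * (h \<bullet> x - b) < \<omega> x"
        by (auto dest: order_tendstoD)
      then show ?thesis
        by (rule eventually_mono) auto
    qed
  qed
  then obtain e where e: "\<And>x. x \<in> A \<Longrightarrow> a \<bullet> x + c + e * (h \<bullet> x - b) \<le> \<omega> x"
    "\<And>x. x \<in> A \<Longrightarrow> a \<bullet> x + c + e * (h \<bullet> x - b) = \<omega> x \<Longrightarrow> x \<in> ?M \<and> h \<bullet> x = b"
    using eventually_happens'[OF trivial_limit_at_right_real] by blast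
  define a' where "a' = a + e *\<^sub>R h"
  define c' where "c' = c - e * b"
  have eq: "a' \<bullet> x + c' = a \<bullet> x + c + e * (h \<bullet> x - b)" for x
    by (simp add: a'_def c'_def algebra_simps)
  have "minorant A \<omega> a' c'"
    using e(1) by (auto simp: minorant_def eq)
  moreover have "contact A \<omega> a' c' = ?M \<inter> {x. h \<bullet> x = b}"
    using e(2) by (auto simp: contact_def eq)
  moreover have "convex hull ?M \<inter> {x. h \<bullet> x = b} = convex hull (?M \<inter> {x. h \<bullet> x = b})"
    using le finite_contact[OF assms(1)] by (intro convex_hull_Int_supporting_hyperplane) auto
  ultimately show ?thesis
    unfolding contact_complex_def by (metis (mono_tags, lifting) mem_Collect_eq)
qed

lemma face_in_contact_complex:
  assumes "finite A" "minorant A \<omega> a c" "F face_of convex hull (contact A \<omega> a c)"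
  shows "F \<in> contact_complex A \<omega>"
proof -
  let ?M = "contact A \<omega> a c"
  have "finite ?M"
    using assms(1) by (rule finite_contact)
  then have "F exposed_face_of convex hull ?M"
    using assms(3) by (simp add: exposed_face_of_polyhedron polytope_convex_hull polytope_imp_polyhedron)
  then obtain h b where hb: "convex hull ?M \<subseteq> {x. h \<bullet> x \<le> b}" "F = convex hull ?M \<inter> {x. h \<bullet> x = b}"
    unfolding exposed_face_of_def by blast
  show ?thesis
    unfolding hb(2) using hb(1) hull_subset[of ?M convex]
    by (intro exposed_in_contact_complex[OF assms(1,2)]) auto
qed

text \<open>The empty set is a lower face of every lifted polytope, so regularity needs it as a
  cell. A constant strictly below all heights touches nothing.\<close>

lemma empty_in_contact_complex:
  assumes "finite A"
  shows "{} \<in> contact_complex A \<omega>"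
proof (cases "A = {}")
  case True
  then show ?thesis
    by (auto simp: contact_complex_def minorant_def contact_def)
next
  case False
  define c where "c = Min (\<omega> ` A) - 1"
  have "c < \<omega> x" if "x \<in> A" for x
    using Min_le[OF finite_imageI[OF assms] imageI[OF that], of \<omega>] by (simp add: c_def)
  then have "minorant A \<omega> 0 c" "contact A \<omega> 0 c = {}"
    by (force simp: minorant_def contact_def)+
  then show ?thesis
    unfolding contact_complex_def by (metis (mono_tags, lifting) convex_hull_empty mem_Collect_eq)
qed

text \<open>The difference of the two minorants separates the cells: where one touches the height,
  the other is at most the height. Hence the cells meet exactly in the points of \<open>S\<close> at
  which the minorants agree.\<close>

lemma contact_complex_Int_face_of:
  assumes "finite A" "S \<in> contact_complex A \<omega>" "T \<in> contact_complex A \<omega>"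
  shows "(S \<inter> T) face_of S"
proof -
  obtain a c where ac: "minorant A \<omega> a c" "S = convex hull (contact A \<omega> a c)"
    using assms(2) by (auto simp: contact_complex_def)
  obtain a' c' where ac': "minorant A \<omega> a' c'" "T = convex hull (contact A \<omega> a' c')"
    using assms(3) by (auto simp: contact_complex_def)
  have le: "(a' - a) \<bullet> x \<le> c - c'" if "x \<in> contact A \<omega> a c" for x
    using that ac'(1) by (force simp: contact_def minorant_def inner_diff_left)
  have "contact A \<omega> a' c' \<subseteq> {x. (a' - a) \<bullet> x \<ge> c - c'}"
    using ac(1) by (force simp: contact_def minorant_def inner_diff_left)
  then have T: "T \<subseteq> {x. (a' - a) \<bullet> x \<ge> c - c'}"
    unfolding ac'(2) by (intro hull_minimal convex_halfspace_ge)
  have S: "S \<subseteq> {x. (a' - a) \<bullet> x \<le> c - c'}"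
    unfolding ac(2) using le by (intro hull_minimal convex_halfspace_le) blast
  have "S \<inter> {x. (a' - a) \<bullet> x = c - c'} = convex hull (contact A \<omega> a c \<inter> {x. (a' - a) \<bullet> x = c - c'})"
    unfolding ac(2) using finite_contact[OF assms(1)] le
    by (intro convex_hull_Int_supporting_hyperplane) auto
  also have "\<dots> \<subseteq> T"
    unfolding ac'(2) by (intro hull_mono) (auto simp: contact_def inner_diff_left)
  finally have "S \<inter> T = S \<inter> {x. (a' - a) \<bullet> x = c - c'}"
    using S T by fastforce
  also have "\<dots> face_of S"
    using S by (intro face_of_Int_supporting_hyperplane_le) (auto simp: ac(2))
  finally show ?thesis .
qed

text \<open>For finite sets of lattice points this says that the vectors (v, 1) are part of a basis
  of the integer lattice in one dimension more. The coefficients are real, so that affine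
  independence is a consequence.\<close>

definition primitive :: "(real ^ 'n::finite) set \<Rightarrow> bool" where
  "primitive M \<longleftrightarrow> (\<forall>c. sum c M \<in> \<int> \<longrightarrow> (\<Sum>v\<in>M. c v *\<^sub>R v) \<in> integer_points \<longrightarrow> (\<forall>v\<in>M. c v \<in> \<int>))"

text \<open>A nonzero affine relation could be scaled to have a non-integral coefficient.\<close>

lemma primitive_imp_affine_independent:
  assumes "primitive M" "finite M"
  shows "\<not> affine_dependent M"
proof
  assume "affine_dependent M"
  then obtain u v where u: "sum u M = 0" "v \<in> M" "u v \<noteq> 0" "(\<Sum>v\<in>M. u v *\<^sub>R v) = 0"
    using assms(2) by (auto simp: affine_dependent_explicit_finite)
  define c where "c w = u w / (2 * u v)" for w
  have "sum c M = 0" "(\<Sum>w\<in>M. c w *\<^sub>R w) = (1 / (2 * u v)) *\<^sub>R (\<Sum>w\<in>M. u w *\<^sub>R w)"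
    using u(1) by (simp_all add: c_def scaleR_sum_right flip: sum_divide_distrib)
  then have "c v \<in> \<int>"
    using assms(1)[unfolded primitive_def, rule_format, of c v] u(2,4)
    by (simp add: integer_points_def)
  then obtain k where "1 / 2 = real_of_int k"
    using u(3) by (auto simp: c_def elim: Ints_cases)
  then have "real_of_int (2 * k) = 1"
    by simp
  then have "2 * k = 1"
    unfolding of_int_eq_1_iff .
  then show False
    by presburger
qed

lemma primitive_imp_affine_lattice_basis:
  assumes "primitive M" "finite M" "M \<subseteq> integer_points"
  shows "affine_lattice_basis M (affine hull M \<inter> integer_points)"
  unfolding affine_lattice_basis_def
proof (intro conjI)
  show "affine hull M \<inter> integer_points = {\<Sum>v\<in>M. c v *\<^sub>R v |c. (\<forall>v\<in>M. c v \<in> \<int>) \<and> sum c M = 1}"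
  proof (intro equalityI subsetI)
    fix x assume x: "x \<in> affine hull M \<inter> integer_points"
    then obtain c where c: "sum c M = 1" "(\<Sum>v\<in>M. c v *\<^sub>R v) = x"
      using assms(2) by (auto simp: affine_hull_finite)
    then have "\<forall>v\<in>M. c v \<in> \<int>"
      using assms(1) x by (auto simp: primitive_def)
    with c show "x \<in> {\<Sum>v\<in>M. c v *\<^sub>R v |c. (\<forall>v\<in>M. c v \<in> \<int>) \<and> sum c M = 1}"
      by blast
  next
    fix x assume "x \<in> {\<Sum>v\<in>M. c v *\<^sub>R v |c. (\<forall>v\<in>M. c v \<in> \<int>) \<and> sum c M = 1}"
    then obtain c where c: "\<forall>v\<in>M. c v \<in> \<int>" "sum c M = 1" "x = (\<Sum>v\<in>M. c v *\<^sub>R v)"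
      by blast
    have "x \<in> integer_points"
      using c(1) assms(3) unfolding c(3)
      by (auto simp: integer_points_def intro!: Ints_sum Ints_mult)
    then show "x \<in> affine hull M \<inter> integer_points"
      using c(2,3) assms(2) by (auto simp: affine_hull_finite)
  qed
qed (use assms primitive_imp_affine_independent in auto)

proposition contact_complex_regular_unimodular:
  fixes A :: "(real ^ 'n::finite) set"
  assumes fin: "finite A" and int: "A \<subseteq> integer_points"
    and prim: "\<And>a c. minorant A \<omega> a c \<Longrightarrow> primitive (contact A \<omega> a c)"
  shows "lattice_triangulation (contact_complex A \<omega>) (convex hull A)"
    and "unimodular (contact_complex A \<omega>) (convex hull A)"
    and "regular (contact_complex A \<omega>)"
proof -
  let ?\<T> = "contact_complex A \<omega>"
  have finM: "finite (contact A \<omega> a c)" for a c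
    using fin by (rule finite_contact)
  have indep: "\<not> affine_dependent (contact A \<omega> a c)" if "minorant A \<omega> a c" for a c
    using primitive_imp_affine_independent[OF prim[OF that] finM] .
  have vertices: "polytope_vertices (convex hull (contact A \<omega> a c)) = contact A \<omega> a c"
    if "minorant A \<omega> a c" for a c
    using extreme_point_of_convex_hull_affine_independent[OF indep[OF that]]
    by (auto simp: polytope_vertices_def)
  have vset: "vertex_set ?\<T> = \<Union>{contact A \<omega> a c | a c. minorant A \<omega> a c}"
    unfolding vertex_set_def contact_complex_def using vertices by blast
  have complex: "simplicial_complex ?\<T>"
    unfolding simplicial_complex_def
  proof (intro conjI allI ballI impI)
    have "?\<T> \<subseteq> (\<lambda>M. convex hull M) ` Pow A"
      using contact_subset unfolding contact_complex_def by blast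
    then show "finite ?\<T>"
      using fin by (meson finite_Pow_iff finite_imageI finite_subset)
  next
    fix S assume "S \<in> ?\<T>"
    then show "\<exists>n. n simplex S"
      unfolding contact_complex_def simplex_def
      by (smt (verit, del_insts) indep mem_Collect_eq diff_add_cancel)
  next
    fix F S assume "S \<in> ?\<T> \<and> F face_of S"
    moreover from this obtain a c where "minorant A \<omega> a c" "S = convex hull (contact A \<omega> a c)"
      by (auto simp: contact_complex_def)
    ultimately show "F \<in> ?\<T>"
      using face_in_contact_complex[OF fin] by blast
  next
    fix S T assume "S \<in> ?\<T> \<and> T \<in> ?\<T>"
    then show "(S \<inter> T) face_of S"
      using contact_complex_Int_face_of[OF fin] by blast
  qed
  then show "lattice_triangulation ?\<T> (convex hull A)"
    using int contact_subset
    by (fastforce simp: lattice_triangulation_def Union_contact_complex[OF fin] vset)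
  show "unimodular ?\<T> (convex hull A)"
    unfolding unimodular_def
  proof (intro ballI impI)
    fix T assume T: "T \<in> ?\<T>" "aff_dim T = aff_dim (convex hull A)"
    then obtain a c where ac: "minorant A \<omega> a c" "T = convex hull (contact A \<omega> a c)"
      by (auto simp: contact_complex_def)
    have "T \<subseteq> convex hull A"
      unfolding ac by (intro hull_mono contact_subset)
    then have "affine hull T = affine hull (convex hull A)"
      using T(2) aff_dim_eq_full_gen by blast
    then have "affine hull (convex hull A) = affine hull (contact A \<omega> a c)"
      by (simp add: ac affine_hull_convex_hull)
    then show "affine_lattice_basis (polytope_vertices T) (affine hull (convex hull A) \<inter> integer_points)"
      using primitive_imp_affine_lattice_basis[OF prim[OF ac(1)] finM] int contact_subset
      by (metis ac vertices subset_trans)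
  qed
  \<comment> \<open>Points of \<open>A\<close> that lie strictly above all minorants are no vertices
    of the complex, and the lifted polytope in \<open>regular\<close> does not see them.\<close>
  define A' where "A' = vertex_set ?\<T>"
  have A': "A' \<subseteq> A" "\<And>a c. minorant A \<omega> a c \<Longrightarrow> contact A \<omega> a c \<subseteq> A'"
    using contact_subset by (fastforce simp: A'_def vset)+
  define Q where "Q = lifted_polytope ?\<T> \<omega>"
  have Q: "Q = convex hull (lift \<omega> ` A')"
    by (simp add: Q_def lifted_polytope_def A'_def)
  have "finite A'"
    using A'(1) fin by (rule finite_subset)
  have slice: "Q \<inter> {z. (a, - 1) \<bullet> z = - c} = (\<lambda>x. (x, a \<bullet> x + c)) ` (convex hull (contact A \<omega> a c))"
    if "minorant A \<omega> a c" for a c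
    unfolding Q using fin that A' by (intro lifted_hull_Int_hyperplane) auto
  have above: "a \<bullet> x + c \<le> t" if "minorant A \<omega> a c" "(x, t) \<in> Q" for a c x t
    using lifted_hull_above_minorant[OF that(1) A'(1)] that(2) by (simp add: Q)
  have sliceface: "(Q \<inter> {z. (a, - 1) \<bullet> z = - c}) face_of Q" if "minorant A \<omega> a c" for a c
    using above[OF that] by (intro face_of_Int_supporting_hyperplane_le) (force simp: Q)+
  have sub: "?\<T> \<subseteq> (\<lambda>F. fst ` F) ` lower_faces Q"
  proof
    fix T assume "T \<in> ?\<T>"
    then obtain a c where ac: "minorant A \<omega> a c" "T = convex hull (contact A \<omega> a c)"
      by (auto simp: contact_complex_def)
    let ?F = "Q \<inter> {z. (a, - 1) \<bullet> z = - c}"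
    have "?F \<subseteq> lower_envelope Q"
      using above[OF ac(1)] by (fastforce simp: lower_envelope_def)
    then have "?F \<in> lower_faces Q"
      using sliceface[OF ac(1)] by (simp add: lower_faces_def)
    moreover have "fst ` ?F = T"
      unfolding slice[OF ac(1)] ac(2) by (simp add: image_image)
    ultimately show "T \<in> (\<lambda>F. fst ` F) ` lower_faces Q"
      by blast
  qed
  have sup: "fst ` F \<in> ?\<T>" if F: "F face_of Q" "F \<subseteq> lower_envelope Q" for F
  proof (cases "F = {}")
    case True
    then show ?thesis
      using empty_in_contact_complex[OF fin] by simp
  next
    case False
    have "convex F"
      using F(1) by (rule face_of_imp_convex)
    then have "rel_interior F \<noteq> {}"
      using False by (simp add: rel_interior_eq_empty)
    then obtain x t where xt: "(x, t) \<in> rel_interior F"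
      by (metis ex_in_conv surj_pair)
    then have xtF: "(x, t) \<in> F"
      using rel_interior_subset by blast
    then have xtQ: "(x, t) \<in> Q"
      using face_of_imp_subset[OF F(1)] by blast
    have "fst ` Q = convex hull (fst ` lift \<omega> ` A')"
      unfolding Q by (rule convex_hull_linear_image) (rule linear_fst)
    then have "fst ` Q \<subseteq> convex hull A"
      using A'(1) by (simp add: image_image hull_mono)
    then have "x \<in> convex hull A"
      using xtQ by force
    then obtain a c where ac: "minorant A \<omega> a c" "x \<in> convex hull (contact A \<omega> a c)"
      using minorant_touching[OF fin] by metis
    let ?H = "Q \<inter> {z. (a, - 1) \<bullet> z = - c}"
    have "(x, a \<bullet> x + c) \<in> Q"
      using slice[OF ac(1)] ac(2) by blast
    then have "t \<le> a \<bullet> x + c"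
      using F(2) xtF by (auto simp: lower_envelope_def)
    then have "(x, t) \<in> ?H"
      using above[OF ac(1) xtQ] xtQ by simp
    \<comment> \<open>A face of \<open>Q\<close> that contains a relative interior point of
      \<open>F\<close> contains all of \<open>F\<close>.\<close>
    then have "F \<subseteq> ?H"
      using xt F(1) by (intro subset_of_face_of[OF sliceface[OF ac(1)]]) (auto dest: face_of_imp_subset)
    then have "F face_of ?H"
      using F(1) by (intro face_of_subset[OF F(1)]) auto
    moreover have "polyhedron ?H"
      unfolding slice[OF ac(1)] convex_hull_affine_graph[symmetric]
      using finM by (intro polytope_imp_polyhedron polytope_convex_hull) auto
    ultimately have "F exposed_face_of ?H"
      by (simp add: exposed_face_of_polyhedron)
    then obtain p b where pb: "?H \<subseteq> {z. p \<bullet> z \<le> b}" "F = ?H \<inter> {z. p \<bullet> z = b}"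
      unfolding exposed_face_of_def by blast
    obtain h k where hk: "p = (h, k)"
      by (cases p)
    let ?g = "\<lambda>x. (x, a \<bullet> x + c)"
    \<comment> \<open>On the graph of the minorant the last coordinate is affine in
      \<open>x\<close>, so the functional exposing \<open>F\<close> in the slice descends to one
      that exposes its projection in the cell.\<close>
    have in_product: "p \<bullet> ?g x = (h + k *\<^sub>R a) \<bullet> x + k * c" for x
      by (simp add: hk algebra_simps)
    have "fst ` F = convex hull (contact A \<omega> a c) \<inter> {x. (h + k *\<^sub>R a) \<bullet> x = b - k * c}"
      unfolding pb(2) slice[OF ac(1)] using in_product by force
    also have "\<dots> \<in> ?\<T>"
    proof (rule exposed_in_contact_complex[OF fin ac(1)])
      fix x assume "x \<in> contact A \<omega> a c"
      then have "?g x \<in> ?H"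
        unfolding slice[OF ac(1)] by (simp add: hull_inc)
      then have "p \<bullet> ?g x \<le> b"
        using pb(1) by blast
      then show "(h + k *\<^sub>R a) \<bullet> x \<le> b - k * c"
        unfolding in_product by simp
    qed
    finally show ?thesis .
  qed
  show "regular ?\<T>"
    unfolding regular_def
  proof
    have "(\<lambda>F. fst ` F) ` lower_faces Q \<subseteq> ?\<T>"
      using sup unfolding lower_faces_def by blast
    then show "?\<T> = (\<lambda>F. fst ` F) ` lower_faces (lifted_polytope ?\<T> \<omega>)"
      using sub unfolding Q_def by (rule equalityI[rotated])
  qed
qed

section \<open>Exchange arguments and doubling\<close>

text \<open>The integer vectors form a chain whose steps have entries 0 and 1. In an entry where the
  largest vector differs from the second largest, it exceeds all others by exactly one. Subtracting
  a multiple of the coefficient sum from the combination in this entry isolates the top coefficient,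
  and the top element can be removed.\<close>

lemma chain_coefficients_integral:
  fixes f :: "'a \<Rightarrow> 'k \<Rightarrow> int" and c :: "'a \<Rightarrow> real"
  assumes "finite M" "inj_on f M"
    and "\<And>x y. x \<in> M \<Longrightarrow> y \<in> M \<Longrightarrow>
      (\<forall>k. f x k \<le> f y k \<and> f y k \<le> f x k + 1) \<or> (\<forall>k. f y k \<le> f x k \<and> f x k \<le> f y k + 1)"
    and "sum c M \<in> \<int>" "\<And>k. (\<Sum>x\<in>M. c x * of_int (f x k)) \<in> \<int>"
  shows "\<forall>x\<in>M. c x \<in> \<int>"
  using assms
proof (induction "card M" arbitrary: M)
  case 0
  then show ?case
    by simp
next
  case (Suc n)
  note fin = Suc.prems(1) and inj = Suc.prems(2) and chain = Suc.prems(3)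
  have max: "\<exists>m\<in>S. \<forall>x\<in>S. \<forall>k. f x k \<le> f m k" if "S \<subseteq> M" "S \<noteq> {}" for S
  proof -
    have "finite (f ` S)" "f ` S \<noteq> {}"
      using that fin by (auto intro: finite_subset)
    then obtain m where m: "m \<in> S" "\<forall>x\<in>S. f m \<le> f x \<longrightarrow> f m = f x"
      using finite_has_maximal[of "f ` S"] by auto
    have "f x k \<le> f m k" if "x \<in> S" for x k
    proof (cases "f m \<le> f x")
      case True
      then show ?thesis
        using m(2) that by auto
    next
      case False
      then show ?thesis
        using chain[of x m] that m(1) \<open>S \<subseteq> M\<close> unfolding le_fun_def by blast
    qed
    then show ?thesis
      using m(1) by blast
  qed
  have "M \<noteq> {}"
    using Suc.hyps(2) by auto
  then obtain m where m: "m \<in> M" "\<And>x k. x \<in> M \<Longrightarrow> f x k \<le> f m k"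
    using max[of M] by auto
  have split: "sum g M = g m + sum g (M - {m})" for g :: "'a \<Rightarrow> real"
    using fin m(1) by (simp add: sum.remove)
  have "c m \<in> \<int>"
  proof (cases "M - {m} = {}")
    case True
    then show ?thesis
      using Suc.prems(4) split[of c] by (simp only: True sum.empty add_0_right)
  next
    case False
    then obtain m' where m': "m' \<in> M - {m}" "\<And>x k. x \<in> M - {m} \<Longrightarrow> f x k \<le> f m' k"
      using max[of "M - {m}"] by auto
    then have "f m \<noteq> f m'"
      using inj m(1) by (auto dest: inj_onD)
    then obtain k where k: "f m k \<noteq> f m' k"
      by blast
    \<comment> \<open>\<open>f x k\<close> lies between \<open>f m k - 1\<close> and
      \<open>f m' k\<close>, and the latter is already smaller than \<open>f m k\<close>.\<close>
    have fx: "f x k = f m k - 1" if "x \<in> M - {m}" for x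
    proof -
      have "f x k \<le> f m' k" "f m' k \<le> f m k"
        using m'(2) that m(2) m'(1) by auto
      moreover have "f m k \<le> f x k + 1"
        using chain[of x m] that m by (smt (verit) DiffD1)
      ultimately show ?thesis
        using k by linarith
    qed
    have "(\<Sum>x\<in>M. c x * of_int (f x k)) = c m * of_int (f m k) + (\<Sum>x\<in>M - {m}. c x * of_int (f m k - 1))"
      by (simp add: split fx)
    also have "\<dots> = c m + of_int (f m k - 1) * sum c M"
      by (simp add: split[of c] sum_distrib_left sum_distrib_right algebra_simps flip: sum_subtractf)
    finally have "c m = (\<Sum>x\<in>M. c x * of_int (f x k)) - of_int (f m k - 1) * sum c M"
      by simp
    then show ?thesis
      using Suc.prems(4,5) by (metis Ints_diff Ints_mult Ints_of_int)
  qed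
  moreover have "\<forall>x\<in>M - {m}. c x \<in> \<int>"
  proof (rule Suc.hyps(1))
    show "n = card (M - {m})"
      using Suc.hyps(2) m(1) fin by simp
    show "sum c (M - {m}) \<in> \<int>"
      using Suc.prems(4) \<open>c m \<in> \<int>\<close> split[of c] by (metis Ints_diff add_diff_cancel_left')
    show "(\<Sum>x\<in>M - {m}. c x * of_int (f x k)) \<in> \<int>" for k
      using Suc.prems(5)[of k] \<open>c m \<in> \<int>\<close> split[of "\<lambda>x. c x * of_int (f x k)"]
      by (metis Ints_diff Ints_mult Ints_of_int add_diff_cancel_left')
  qed (use fin inj chain in \<open>auto intro: inj_on_subset\<close>)
  ultimately show ?case
    by blast
qed

text \<open>No linear functional occurs here, which is what lets the condition pass from points to
  their summands. The tuples may repeat points.\<close>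

definition exchange_minimal :: "nat \<Rightarrow> 'a::comm_monoid_add set \<Rightarrow> ('a \<Rightarrow> real) \<Rightarrow> 'a set \<Rightarrow> bool" where
  "exchange_minimal N A \<omega> X \<longleftrightarrow> X \<subseteq> A \<and> (\<forall>m\<le>N. \<forall>x y. (\<forall>i<m. x i \<in> X \<and> y i \<in> A) \<longrightarrow>
     (\<Sum>i<m. x i) = (\<Sum>i<m. y i) \<longrightarrow> (\<Sum>i<m. \<omega> (x i)) \<le> (\<Sum>i<m. \<omega> (y i)))"

lemma exchange_minimalD:
  assumes "exchange_minimal N A \<omega> X" "m \<le> N" "\<And>i. i < m \<Longrightarrow> x i \<in> X" "\<And>i. i < m \<Longrightarrow> y i \<in> A"
    "(\<Sum>i<m. x i) = (\<Sum>i<m. y i)"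
  shows "(\<Sum>i<m. \<omega> (x i)) \<le> (\<Sum>i<m. \<omega> (y i))"
  using assms unfolding exchange_minimal_def by blast

lemma exchange_minimal_pairD:
  assumes "exchange_minimal N A \<omega> X" "2 \<le> N" "x \<in> X" "x' \<in> X" "y \<in> A" "y' \<in> A" "x + x' = y + y'"
  shows "\<omega> x + \<omega> x' \<le> \<omega> y + \<omega> y'"
  using exchange_minimalD[OF assms(1,2), of "\<lambda>i. if i = 0 then x else x'" "\<lambda>i. if i = 0 then y else y'"] assms(3-)
  by (simp add: numeral_2_eq_2)

text \<open>The total of an affine function over a tuple depends only on the sum and the length of
  the tuple; the minorant is tight on one side and a lower bound on the other.\<close>

lemma exchange_minimal_contact:
  assumes "minorant A \<omega> a c"
  shows "exchange_minimal N A \<omega> (contact A \<omega> a c)"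
  unfolding exchange_minimal_def
proof (intro conjI contact_subset allI impI)
  fix m and x y :: "nat \<Rightarrow> 'a"
  assume xy: "\<forall>i<m. x i \<in> contact A \<omega> a c \<and> y i \<in> A" and eq: "(\<Sum>i<m. x i) = (\<Sum>i<m. y i)"
  have "(\<Sum>i<m. \<omega> (x i)) = (\<Sum>i<m. a \<bullet> x i + c)"
    using xy by (intro sum.cong) (auto simp: contact_def)
  also have "\<dots> = (\<Sum>i<m. a \<bullet> y i + c)"
    using eq by (simp add: sum.distrib flip: inner_sum_right)
  also have "\<dots> \<le> (\<Sum>i<m. \<omega> (y i))"
    using xy assms by (intro sum_mono) (auto simp: minorant_def)
  finally show "(\<Sum>i<m. \<omega> (x i)) \<le> (\<Sum>i<m. \<omega> (y i))" .
qed

text \<open>Quantifying over all exchange-minimal sets makes the notion applicable to sets of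
  summands. Integrality of the heights serves the doubling, where a gain smaller than one has to be
  no gain.\<close>

definition unimodular_height :: "nat \<Rightarrow> (real ^ 'n::finite) set \<Rightarrow> (real ^ 'n \<Rightarrow> real) \<Rightarrow> bool" where
  "unimodular_height N A \<omega> \<longleftrightarrow> finite A \<and> A \<subseteq> integer_points \<and> \<omega> ` A \<subseteq> \<int> \<and>
     (\<forall>X. exchange_minimal N A \<omega> X \<longrightarrow> primitive X)"

corollary unimodular_height_triangulation:
  assumes "unimodular_height N A \<omega>"
  shows "\<exists>\<T>. lattice_triangulation \<T> (convex hull A) \<and> unimodular \<T> (convex hull A) \<and> regular \<T>"
  using assms contact_complex_regular_unimodular[of A \<omega>] exchange_minimal_contact[of A \<omega>]
  unfolding unimodular_height_def by blast

section \<open>Doubling a configuration\<close>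

lemma integer_points_diff: "x \<in> integer_points \<Longrightarrow> y \<in> integer_points \<Longrightarrow> x - y \<in> integer_points"
  by (simp add: integer_points_def)

lemma integer_points_add: "x \<in> integer_points \<Longrightarrow> y \<in> integer_points \<Longrightarrow> x + y \<in> integer_points"
  by (simp add: integer_points_def)

lemma integer_points_scaleR: "k \<in> \<int> \<Longrightarrow> x \<in> integer_points \<Longrightarrow> k *\<^sub>R x \<in> integer_points"
  by (simp add: integer_points_def)

text \<open>A strictly concave, increasing reward for the distance of the ranks of the two summands favours
  the interleaved pairing of four ranks.\<close>

lemma interleaved_if_optimal_pairing:
  fixes a b a' b' n :: real
  defines "h \<equiv> \<lambda>x y. (x - y)\<^sup>2 - 2 * n * \<bar>x - y\<bar>"
  assumes ord: "a \<le> b" "a' \<le> b'" and le: "a \<le> a'"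
    and range: "0 \<le> a" "b < n" "b' < n"
    and opt1: "h a b + h a' b' \<le> h a a' + h b b'"
    and opt2: "h a b + h a' b' \<le> h a b' + h a' b"
  shows "a' \<le> b \<and> b \<le> b' \<or> a' \<le> a \<and> a \<le> b' \<and> b' \<le> b"
proof -
  \<comment> \<open>The parabola t^2 - 2 n t is strictly decreasing for t up to n. Two disjoint
    intervals can thus be improved by joining left ends and right ends, which lengthens both
    distances.\<close>
  have anti: "E\<^sup>2 - 2 * n * E < D\<^sup>2 - 2 * n * D" if "0 \<le> D" "D < E" "E < n" for D E
  proof -
    have "(E - D) * (E + D - 2 * n) < 0"
      using that by (intro mult_pos_neg) auto
    then show ?thesis
      by (simp add: algebra_simps power2_eq_square)
  qed
  have h_eq: "h x y = (y - x)\<^sup>2 - 2 * n * (y - x)" if "x \<le> y" for x y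
    using that unfolding h_def power2_commute[of x] by simp
  have "a' \<le> b"
  proof (rule ccontr)
    assume "\<not> a' \<le> b"
    then have "h a a' < h a b" "h b b' < h a' b'"
      using anti[of "b - a" "a' - a"] anti[of "b' - a'" "b' - b"] ord le range
      by (simp_all add: h_eq)
    then show False
      using opt1 by linarith
  qed
  moreover have "a' \<le> a" if "b' < b"
  proof (rule ccontr)
    assume "\<not> a' \<le> a"
    \<comment> \<open>For nested intervals, exchanging the right ends keeps the total distance and
      lowers the sum of squares by twice this product.\<close>
    then have "(a' - a) * (b - b') > 0"
      using that by simp
    moreover have "h a b = (b - a)\<^sup>2 - 2 * n * (b - a)" "h a' b' = (b' - a')\<^sup>2 - 2 * n * (b' - a')"
      "h a b' = (b' - a)\<^sup>2 - 2 * n * (b' - a)" "h a' b = (b - a')\<^sup>2 - 2 * n * (b - a')"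
      using ord le that by (auto intro!: h_eq)
    ultimately show False
      using opt2 by (simp add: power2_eq_square algebra_simps)
  qed
  ultimately show ?thesis
    using le ord by linarith
qed

text \<open>The height of a point of the doubled configuration is its cheapest decomposition, scaled so much
  that the reward for the distance of the ranks only decides between decompositions of equal height.\<close>

proposition unimodular_height_double:
  fixes A :: "(real ^ 'n::finite) set"
  assumes A: "unimodular_height N A \<omega>" and "2 \<le> N" and v: "v \<in> integer_points"
  shows "\<exists>\<omega>'. unimodular_height N {v + x + y | x y. x \<in> A \<and> y \<in> A} \<omega>'"
proof -
  have fin: "finite A" and int: "A \<subseteq> integer_points" and \<omega>int: "\<And>x. x \<in> A \<Longrightarrow> \<omega> x \<in> \<int>"
    and prim: "\<And>X. exchange_minimal N A \<omega> X \<Longrightarrow> primitive X"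
    using A by (auto simp: unimodular_height_def)
  \<comment> \<open>Any enumeration of \<open>A\<close> can serve as ranking, since ranks only break
    ties. Ranks are integers, which keeps the new heights integral.\<close>
  obtain n and \<rho> :: "real ^ 'n \<Rightarrow> nat" where \<rho>: "\<rho> ` A = {i. i < n}" "inj_on \<rho> A"
    using finite_imp_inj_to_nat_seg[OF fin] by blast
  define r where "r x = real (\<rho> x)" for x
  have r_range: "0 \<le> r x" "r x < n" if "x \<in> A" for x
    using \<rho>(1) that by (auto simp: r_def)
  define h where "h x y = (r x - r y)\<^sup>2 - 2 * real n * \<bar>r x - r y\<bar>" for x y
  have h_bounds: "- 2 * real n ^ 2 \<le> h x y" "h x y \<le> 0" if "x \<in> A" "y \<in> A" for x y
  proof -
    define D where "D = \<bar>r x - r y\<bar>"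
    have D: "0 \<le> D" "D \<le> real n"
      using r_range[OF that(1)] r_range[OF that(2)] by (simp_all add: D_def)
    have hD: "h x y = D\<^sup>2 - 2 * real n * D"
      by (simp add: D_def h_def)
    have "n * D \<le> real n * n"
      using D by (intro mult_left_mono) auto
    then show "- 2 * real n ^ 2 \<le> h x y"
      using zero_le_square[of D] unfolding hD power2_eq_square mult.assoc by linarith
    have "D * D \<le> n * D"
      using D by (intro mult_right_mono) auto
    then show "h x y \<le> 0"
      using zero_le_square[of D] unfolding hD power2_eq_square mult.assoc by linarith
  qed
  \<comment> \<open>Each reward lies between -2 n^2 and 0, so the totals of up to \<open>N\<close>
    rewards differ by at most \<open>K - 1\<close>.\<close>
  define K where "K = real N * (2 * real n ^ 2) + 1"
  define cost where "cost x y = K * (\<omega> x + \<omega> y) + h x y" for x y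
  have cost_sym: "cost x y = cost y x" for x y
    by (simp add: cost_def h_def abs_minus_commute power2_commute add.commute)
  define B where "B = {v + x + y | x y. x \<in> A \<and> y \<in> A}"
  have B_mem: "v + x + y \<in> B" if "x \<in> A" "y \<in> A" for x y
    using that by (auto simp: B_def)
  have finB: "finite B"
    by (rule finite_subset[of _ "(\<lambda>(x, y). v + x + y) ` (A \<times> A)"]) (use fin in \<open>auto simp: B_def\<close>)
  define C where "C z = {cost x y | x y. x \<in> A \<and> y \<in> A \<and> v + x + y = z}" for z
  define \<omega>' where "\<omega>' z = Min (C z)" for z
  have finC: "finite (C z)" for z
    by (rule finite_subset[of _ "case_prod cost ` (A \<times> A)"]) (use fin in \<open>auto simp: C_def\<close>)
  have \<omega>'_le: "\<omega>' (v + x + y) \<le> cost x y" if "x \<in> A" "y \<in> A" for x y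
    unfolding \<omega>'_def using that by (intro Min_le finC) (auto simp: C_def)
  have "\<exists>x y. x \<in> A \<and> y \<in> A \<and> v + x + y = z \<and> \<omega>' z = cost x y \<and> r x \<le> r y" if "z \<in> B" for z
  proof -
    have "C z \<noteq> {}"
      using that by (auto simp: B_def C_def)
    then have "\<omega>' z \<in> C z"
      unfolding \<omega>'_def by (rule Min_in[OF finC])
    then obtain x y where "x \<in> A" "y \<in> A" "v + x + y = z" "\<omega>' z = cost x y"
      by (auto simp: C_def)
    then show ?thesis
      by (cases "r x \<le> r y") (auto simp: cost_sym add.commute add.left_commute intro: exI[of _ y] exI[of _ x])
  qed
  then obtain p q where pq: "\<And>z. z \<in> B \<Longrightarrow> p z \<in> A" "\<And>z. z \<in> B \<Longrightarrow> q z \<in> A"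
    "\<And>z. z \<in> B \<Longrightarrow> v + p z + q z = z" "\<And>z. z \<in> B \<Longrightarrow> \<omega>' z = cost (p z) (q z)"
    "\<And>z. z \<in> B \<Longrightarrow> r (p z) \<le> r (q z)"
    by metis
  have "primitive Z" if Z: "exchange_minimal N B \<omega>' Z" for Z
  proof -
    have ZB: "Z \<subseteq> B"
      using Z by (simp add: exchange_minimal_def)
    then have finZ: "finite Z"
      using finB by (rule finite_subset)
    define X where "X = p ` Z \<union> q ` Z"
    have XA: "X \<subseteq> A" and finX: "finite X"
      using ZB pq(1,2) finZ by (auto simp: X_def)
    have "exchange_minimal N A \<omega> X"
      unfolding exchange_minimal_def
    proof (intro conjI XA allI impI)
      fix m and x y :: "nat \<Rightarrow> real ^ 'n"
      assume m: "m \<le> N" and xy: "\<forall>i<m. x i \<in> X \<and> y i \<in> A" and eq: "(\<Sum>i<m. x i) = (\<Sum>i<m. y i)"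
      \<comment> \<open>Each \<open>x i\<close> keeps its partner \<open>u i\<close> from an optimal
        decomposition. Replacing \<open>x i + u i\<close> by \<open>y i + u i\<close> is then an
        exchange for \<open>Z\<close>, and the costs of the partners cancel.\<close>
      have "\<exists>u. u \<in> A \<and> v + x i + u \<in> Z \<and> \<omega>' (v + x i + u) = cost (x i) u" if i: "i < m" for i
      proof -
        have "x i \<in> X"
          using xy i by blast
        then obtain z where z: "z \<in> Z" "x i = p z \<or> x i = q z"
          by (auto simp: X_def)
        then have "z \<in> B"
          using ZB by blast
        note pqz = pq[OF this]
        from z(2) show ?thesis
        proof
          assume "x i = p z"
          then show ?thesis
            using pqz z(1) by (intro exI[of _ "q z"]) simp
        next
          assume "x i = q z"
          moreover have "v + q z + p z = z"
            using pqz(3) by (simp add: algebra_simps)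
          ultimately show ?thesis
            using pqz z(1) cost_sym by (intro exI[of _ "p z"]) simp
        qed
      qed
      then obtain u where u: "\<And>i. i < m \<Longrightarrow> u i \<in> A" "\<And>i. i < m \<Longrightarrow> v + x i + u i \<in> Z"
        "\<And>i. i < m \<Longrightarrow> \<omega>' (v + x i + u i) = cost (x i) (u i)"
        by metis
      have "(\<Sum>i<m. cost (x i) (u i)) = (\<Sum>i<m. \<omega>' (v + x i + u i))"
        using u(3) by (intro sum.cong) auto
      also have "\<dots> \<le> (\<Sum>i<m. \<omega>' (v + y i + u i))"
        using u(1,2) xy eq by (intro exchange_minimalD[OF Z m]) (auto simp: sum.distrib B_mem)
      also have "\<dots> \<le> (\<Sum>i<m. cost (y i) (u i))"
        using u(1) xy by (intro sum_mono \<omega>'_le) auto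
      finally have le: "(\<Sum>i<m. cost (x i) (u i)) \<le> (\<Sum>i<m. cost (y i) (u i))" .
      have cost_sum: "(\<Sum>i<m. cost (w i) (u i))
          = K * (\<Sum>i<m. \<omega> (w i)) + K * (\<Sum>i<m. \<omega> (u i)) + (\<Sum>i<m. h (w i) (u i))" for w
        by (simp add: cost_def sum.distrib sum_distrib_left distrib_left)
      have "(\<Sum>i<m. - 2 * real n ^ 2) \<le> (\<Sum>i<m. h (x i) (u i))"
        using h_bounds(1) u(1) xy XA by (intro sum_mono) blast
      moreover have "(\<Sum>i<m. h (y i) (u i)) \<le> 0"
        using h_bounds(2) u(1) xy by (intro sum_nonpos) auto
      moreover have "real m * (2 * real n ^ 2) \<le> real N * (2 * real n ^ 2)"
        using m by (intro mult_right_mono) auto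
      ultimately have "K * (\<Sum>i<m. \<omega> (x i)) - K * (\<Sum>i<m. \<omega> (y i)) \<le> K - 1"
        using le by (simp add: cost_sum K_def)
      moreover have "K > 0"
        by (simp add: K_def add_nonneg_pos)
      ultimately have "K * ((\<Sum>i<m. \<omega> (x i)) - (\<Sum>i<m. \<omega> (y i))) < K * 1"
        by (simp add: right_diff_distrib)
      then have "(\<Sum>i<m. \<omega> (x i)) - (\<Sum>i<m. \<omega> (y i)) < 1"
        using \<open>K > 0\<close> by (simp only: mult_less_cancel_left_pos)
      moreover have "(\<Sum>i<m. \<omega> (x i)) - (\<Sum>i<m. \<omega> (y i)) \<in> \<int>"
        using xy XA \<omega>int by (intro Ints_diff Ints_sum) auto
      ultimately show "(\<Sum>i<m. \<omega> (x i)) \<le> (\<Sum>i<m. \<omega> (y i))"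
        by (elim Ints_cases) simp
    qed
    then have primX: "primitive X"
      by (rule prim)
    have interleaved: "r (p z') \<le> r (q z) \<and> r (q z) \<le> r (q z') \<or>
        r (p z') \<le> r (p z) \<and> r (p z) \<le> r (q z') \<and> r (q z') \<le> r (q z)"
      if zz: "z \<in> Z" "z' \<in> Z" "r (p z) \<le> r (p z')" for z z'
    proof (rule interleaved_if_optimal_pairing[where n = "real n"])
      have zB: "z \<in> B" "z' \<in> B"
        using zz ZB by auto
      note P = pq[OF zB(1)] and P' = pq[OF zB(2)]
      \<comment> \<open>Pairing the four summands differently does not change \<open>z + z'\<close>,
        so no other pairing is cheaper. The values of \<open>\<omega>\<close> agree on both sides
        and only the rank rewards remain.\<close>
      have ex: "\<omega>' z + \<omega>' z' \<le> cost a b + cost a' b'"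
        if "a \<in> A" "b \<in> A" "a' \<in> A" "b' \<in> A" "a + b + a' + b' = p z + q z + p z' + q z'" for a b a' b'
      proof -
        have "\<omega>' z + \<omega>' z' \<le> \<omega>' (v + a + b) + \<omega>' (v + a' + b')"
        proof (rule exchange_minimal_pairD[OF Z \<open>2 \<le> N\<close> zz(1,2)])
          have "z + z' = 2 *\<^sub>R v + (p z + q z + p z' + q z')"
            using P(3) P'(3) by (metis (no_types, lifting) add.assoc add.commute scaleR_2)
          then show "z + z' = v + a + b + (v + a' + b')"
            using that(5) by (simp add: scaleR_2 algebra_simps)
        qed (use that in \<open>auto intro: B_mem\<close>)
        also have "\<dots> \<le> cost a b + cost a' b'"
          using that by (intro add_mono \<omega>'_le) auto
        finally show ?thesis .
      qed
      show "(r (p z) - r (q z))\<^sup>2 - 2 * real n * \<bar>r (p z) - r (q z)\<bar> + ((r (p z') - r (q z'))\<^sup>2 - 2 * real n * \<bar>r (p z') - r (q z')\<bar>)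
        \<le> (r (p z) - r (p z'))\<^sup>2 - 2 * real n * \<bar>r (p z) - r (p z')\<bar> + ((r (q z) - r (q z'))\<^sup>2 - 2 * real n * \<bar>r (q z) - r (q z')\<bar>)"
        using ex[of "p z" "p z'" "q z" "q z'"] P P' by (simp add: cost_def h_def algebra_simps)
      show "(r (p z) - r (q z))\<^sup>2 - 2 * real n * \<bar>r (p z) - r (q z)\<bar> + ((r (p z') - r (q z'))\<^sup>2 - 2 * real n * \<bar>r (p z') - r (q z')\<bar>)
        \<le> (r (p z) - r (q z'))\<^sup>2 - 2 * real n * \<bar>r (p z) - r (q z')\<bar> + ((r (p z') - r (q z))\<^sup>2 - 2 * real n * \<bar>r (p z') - r (q z)\<bar>)"
        using ex[of "p z" "q z'" "p z'" "q z"] P P' by (simp add: cost_def h_def algebra_simps)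
    qed (use zz ZB pq r_range in \<open>auto simp: subset_iff\<close>)
    \<comment> \<open>Counts the summands of \<open>z\<close> of rank at most \<open>k\<close>. Two
      pairs of ranks interleave exactly when one count dominates the other by at most one
      everywhere.\<close>
    define f where "f z k = (of_bool (r (p z) \<le> k) + of_bool (r (q z) \<le> k) :: int)" for z k
    show ?thesis
      unfolding primitive_def
    proof (intro allI impI)
      fix c :: "real ^ 'n \<Rightarrow> real"
      assume c: "sum c Z \<in> \<int>" "(\<Sum>z\<in>Z. c z *\<^sub>R z) \<in> integer_points"
      \<comment> \<open>The coefficient of \<open>x\<close> after expanding every \<open>z\<close>
        into its summands. Primitivity of \<open>X\<close> makes it integral, and the sums of
        \<open>c z * f z k\<close> are sums of these coefficients.\<close>
      define b where "b x = (\<Sum>z\<in>Z. c z * (of_bool (p z = x) + of_bool (q z = x)))" for x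
      have weighted: "(\<Sum>x\<in>X. b x * g x) = (\<Sum>z\<in>Z. c z * (g (p z) + g (q z)))" for g :: "real ^ 'n \<Rightarrow> real"
      proof -
        have "(\<Sum>x\<in>X. b x * g x) = (\<Sum>z\<in>Z. \<Sum>x\<in>X. c z * (of_bool (p z = x) + of_bool (q z = x)) * g x)"
          unfolding b_def sum_distrib_right by (rule sum.swap)
        also have "\<dots> = (\<Sum>z\<in>Z. c z * ((\<Sum>x\<in>X. of_bool (p z = x) * g x) + (\<Sum>x\<in>X. of_bool (q z = x) * g x)))"
          by (simp add: sum_distrib_left sum.distrib algebra_simps)
        also have "\<dots> = (\<Sum>z\<in>Z. c z * (g (p z) + g (q z)))"
          using finX by (intro sum.cong) (auto simp: X_def of_bool_def if_distrib[of "\<lambda>t. t * _"] cong: if_cong)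
        finally show ?thesis .
      qed
      have "\<forall>x\<in>X. b x \<in> \<int>"
      proof (rule primX[unfolded primitive_def, rule_format, THEN ballI])
        show "sum b X \<in> \<int>"
          using weighted[of "\<lambda>_. 1"] c(1) by (simp flip: sum_distrib_right)
        have "(\<Sum>x\<in>X. b x *\<^sub>R x) = (\<Sum>z\<in>Z. c z *\<^sub>R (p z + q z))"
        proof (subst vec_eq_iff, intro allI)
          fix j
          show "(\<Sum>x\<in>X. b x *\<^sub>R x) $ j = (\<Sum>z\<in>Z. c z *\<^sub>R (p z + q z)) $ j"
            using weighted[of "\<lambda>x. x $ j"] by simp
        qed
        also have "\<dots> = (\<Sum>z\<in>Z. c z *\<^sub>R (z - v))"
        proof (intro sum.cong refl)
          fix z assume "z \<in> Z"
          then have "p z + q z = z - v"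
            using pq(3)[of z] ZB by (metis add.assoc add_diff_cancel_left' subsetD)
          then show "c z *\<^sub>R (p z + q z) = c z *\<^sub>R (z - v)"
            by simp
        qed
        also have "\<dots> = (\<Sum>z\<in>Z. c z *\<^sub>R z) - sum c Z *\<^sub>R v"
          by (simp add: scaleR_diff_right sum_subtractf scaleR_sum_left)
        finally show "(\<Sum>x\<in>X. b x *\<^sub>R x) \<in> integer_points"
          using c v by (simp add: integer_points_diff integer_points_scaleR)
      qed
      show "\<forall>z\<in>Z. c z \<in> \<int>"
      proof (rule chain_coefficients_integral[where f = f, OF finZ])
        show "sum c Z \<in> \<int>"
          by (rule c)
        show "(\<Sum>z\<in>Z. c z * of_int (f z k)) \<in> \<int>" for k
        proof -
          have "(\<Sum>z\<in>Z. c z * of_int (f z k)) = (\<Sum>x\<in>X. b x * of_bool (r x \<le> k))"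
            unfolding weighted by (simp add: f_def)
          also have "\<dots> \<in> \<int>"
            using \<open>\<forall>x\<in>X. b x \<in> \<int>\<close> by (intro Ints_sum Ints_mult) auto
          finally show ?thesis .
        qed
        show "(\<forall>k. f z k \<le> f z' k \<and> f z' k \<le> f z k + 1) \<or> (\<forall>k. f z' k \<le> f z k \<and> f z k \<le> f z' k + 1)"
          if "z \<in> Z" "z' \<in> Z" for z z'
          using interleaved[of z z'] interleaved[of z' z] that
          by (cases "r (p z) \<le> r (p z')") (auto simp: f_def)
        show "inj_on f Z"
        proof (rule inj_onI)
          fix z z' assume zz: "z \<in> Z" "z' \<in> Z" and "f z = f z'"
          then have f: "f z k = f z' k" for k
            by simp
          have B: "z \<in> B" "z' \<in> B"
            using zz ZB by auto
          have "r (p z) = r (p z')" "r (q z) = r (q z')"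
            using f[of "r (p z)"] f[of "r (p z')"] f[of "r (q z)"] f[of "r (q z')"] pq(5)[OF B(1)] pq(5)[OF B(2)]
            by (auto simp: f_def split: if_splits simp: of_bool_def)
          then have "p z = p z'" "q z = q z'"
            using \<rho>(2) pq(1,2)[OF B(1)] pq(1,2)[OF B(2)] by (auto simp: r_def dest: inj_onD)
          then show "z = z'"
            using pq(3)[OF B(1)] pq(3)[OF B(2)] by metis
        qed
      qed
    qed
  qed
  moreover have "B \<subseteq> integer_points"
    using int v by (auto simp: B_def intro!: integer_points_add)
  moreover have "\<omega>' ` B \<subseteq> \<int>"
  proof
    fix t assume "t \<in> \<omega>' ` B"
    then obtain z where z: "z \<in> B" "t = \<omega>' z"
      by blast
    then show "t \<in> \<int>"
      using pq(1,2,4)[OF z(1)] \<omega>int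
      by (auto simp: cost_def K_def h_def r_def intro!: Ints_add Ints_mult Ints_diff Ints_power)
  qed
  ultimately show ?thesis
    using finB unfolding unimodular_height_def B_def[symmetric] by blast
qed

section \<open>Dilated simplices and their joins\<close>

text \<open>In these coordinates the dilated standard simplex becomes the set of monotone sequences
  from 0 to \<open>q\<close>, and its alcoves are bounded by hyperplanes on which a difference of
  two partial sums is an integer.\<close>

definition psum :: "('n::finite \<Rightarrow> nat) \<Rightarrow> nat \<Rightarrow> real ^ 'n \<Rightarrow> real" where
  "psum idx k x = (\<Sum>j | idx j \<le> k. x $ j)"

definition of_psum :: "('n::finite \<Rightarrow> nat) \<Rightarrow> (nat \<Rightarrow> real) \<Rightarrow> real ^ 'n" where
  "of_psum idx f = (\<chi> j. f (idx j) - f (idx j - 1))"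

lemma psum_add: "psum idx k (x + y) = psum idx k x + psum idx k y"
  by (simp add: psum_def sum.distrib)

lemma psum_diff: "psum idx k (x - y) = psum idx k x - psum idx k y"
  by (simp add: psum_def sum_subtractf)

lemma psum_scaleR: "psum idx k (c *\<^sub>R x) = c * psum idx k x"
  by (simp add: psum_def sum_distrib_left)

lemma psum_sum: "psum idx k (\<Sum>x\<in>M. g x) = (\<Sum>x\<in>M. psum idx k (g x))"
  unfolding psum_def sum_component by (rule sum.swap)

lemma psum_in_Ints: "x \<in> integer_points \<Longrightarrow> psum idx k x \<in> \<int>"
  by (auto simp: psum_def integer_points_def intro: Ints_sum)

lemma of_psum_add: "of_psum idx f + of_psum idx g = of_psum idx (\<lambda>k. f k + g k)"
  by (simp add: of_psum_def vec_eq_iff)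

section \<open>Partial sums as coordinates and the alcove triangulation\<close>

context
  fixes idx :: "'n::finite \<Rightarrow> nat" and n :: nat
  assumes idx: "bij_betw idx UNIV {1..n}"
begin

lemma idx_inj: "idx i = idx j \<Longrightarrow> i = j"
  using idx by (simp add: bij_betw_def inj_eq)

lemma idx_range: "1 \<le> idx j" "idx j \<le> n"
  using bij_betwE[OF idx] by auto

lemma idx_surj: "1 \<le> k \<Longrightarrow> k \<le> n \<Longrightarrow> \<exists>j. idx j = k"
  using bij_betw_imp_surj_on[OF idx] by (metis atLeastAtMost_iff imageE)

lemma psum_0: "psum idx 0 x = 0"
proof -
  have empty: "{j. idx j \<le> 0} = {}"
    using idx_range(1) by (metis (mono_tags, lifting) Collect_empty_eq le_zero_eq not_one_le_zero)
  show ?thesis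
    unfolding psum_def empty by simp
qed

lemma psum_top: "n \<le> k \<Longrightarrow> psum idx k x = (\<Sum>j\<in>UNIV. x $ j)"
proof -
  assume "n \<le> k"
  then have "{j. idx j \<le> k} = UNIV"
    using idx_range(2) by (auto intro: order_trans)
  then show ?thesis
    by (simp add: psum_def)
qed

lemma psum_Suc:
  assumes "idx j = Suc k"
  shows "psum idx (Suc k) x = psum idx k x + x $ j"
proof -
  have "{i. idx i \<le> Suc k} = insert j {i. idx i \<le> k}"
    using assms idx_inj by (auto simp: le_Suc_eq)
  then show ?thesis
    using assms by (simp add: psum_def)
qed

lemma component_eq_psum: "x $ j = psum idx (idx j) x - psum idx (idx j - 1) x"
  using psum_Suc[of j "idx j - 1" x] idx_range(1)[of j] by simp

lemma of_psum_psum: "of_psum idx (\<lambda>k. psum idx k x) = x"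
  by (simp only: of_psum_def vec_eq_iff vec_lambda_beta component_eq_psum[symmetric] simp_thms)

lemma psum_of_psum: "k \<le> n \<Longrightarrow> psum idx k (of_psum idx f) = f k - f 0"
proof (induction k)
  case 0
  then show ?case
    by (simp add: psum_0)
next
  case (Suc k)
  then obtain j where "idx j = Suc k"
    using idx_surj[of "Suc k"] by auto
  then show ?case
    using Suc by (simp add: psum_Suc of_psum_def)
qed

lemma psum_inject:
  assumes "\<And>k. psum idx k x = psum idx k y"
  shows "x = y"
proof -
  have "(\<lambda>k. psum idx k x) = (\<lambda>k. psum idx k y)"
    using assms by blast
  then show ?thesis
    using of_psum_psum[of x] of_psum_psum[of y] by argo
qed

text \<open>The lattice points of a face of the dilated standard simplex. Restricting to
  \<open>I\<close> only makes the partial sums constant at indices outside \<open>I\<close>, so one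
  quadratic form serves \<open>I\<close> and its complement.\<close>

definition grid :: "'n set \<Rightarrow> nat \<Rightarrow> (real ^ 'n) set" where
  "grid I q = {u \<in> integer_points. (\<forall>j. 0 \<le> u $ j) \<and> (\<forall>j. j \<notin> I \<longrightarrow> u $ j = 0) \<and> (\<Sum>j\<in>UNIV. u $ j) = q}"

text \<open>All pairs of indices occur, including 0, because the alcoves are bounded by hyperplanes
  for all differences of partial sums: equality in the midpoint argument then controls each
  difference separately.\<close>

definition quad :: "real ^ 'n \<Rightarrow> real" where
  "quad x = (\<Sum>k\<le>n. \<Sum>l\<le>n. (psum idx k x - psum idx l x)\<^sup>2)"

definition adjacent :: "real ^ 'n \<Rightarrow> real ^ 'n \<Rightarrow> bool" where
  "adjacent x y \<longleftrightarrow> (\<forall>k. psum idx k x \<le> psum idx k y \<and> psum idx k y \<le> psum idx k x + 1) \<or>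
     (\<forall>k. psum idx k y \<le> psum idx k x \<and> psum idx k x \<le> psum idx k y + 1)"

lemma of_psum_in_grid:
  assumes "\<And>k. f k \<in> \<int>" "\<And>k. f k \<le> f (Suc k)" "f 0 = 0" "f n = q"
    and "\<And>j. j \<notin> I \<Longrightarrow> f (idx j) = f (idx j - 1)"
  shows "of_psum idx f \<in> grid I q"
proof -
  have "f (idx j - 1) \<le> f (idx j)" for j
    using assms(2)[of "idx j - 1"] idx_range(1)[of j] by simp
  moreover have "(\<Sum>j\<in>UNIV. of_psum idx f $ j) = q"
    using psum_of_psum[of n f] assms(3,4) by (simp add: psum_top)
  ultimately show ?thesis
    using assms(1,5) by (auto simp: grid_def integer_points_def of_psum_def)
qed

lemma psum_grid:
  assumes "u \<in> grid I q"
  shows "psum idx k u \<in> \<int>" "psum idx k u \<le> psum idx (Suc k) u" "psum idx n u = q"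
    and "j \<notin> I \<Longrightarrow> psum idx (idx j) u = psum idx (idx j - 1) u"
proof -
  show "psum idx k u \<le> psum idx (Suc k) u"
    using assms unfolding psum_def by (intro sum_mono2) (auto simp: grid_def)
  show "j \<notin> I \<Longrightarrow> psum idx (idx j) u = psum idx (idx j - 1) u"
    using assms component_eq_psum[of u j] by (simp add: grid_def)
qed (use assms in \<open>auto simp: grid_def psum_in_Ints psum_top\<close>)

lemma quad_nonneg: "0 \<le> quad x"
  by (simp add: quad_def sum_nonneg)

lemma quad_0: "quad 0 = 0"
  by (simp add: quad_def psum_def)

lemma quad_in_Ints: "x \<in> integer_points \<Longrightarrow> quad x \<in> \<int>"
  by (simp add: quad_def psum_in_Ints Ints_sum Ints_power Ints_diff)

lemma quad_parallelogram: "2 * (quad x + quad y) = quad (x + y) + quad (x - y)"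
proof -
  have "(psum idx k (x + y) - psum idx l (x + y))\<^sup>2 + (psum idx k (x - y) - psum idx l (x - y))\<^sup>2
      = 2 * ((psum idx k x - psum idx l x)\<^sup>2 + (psum idx k y - psum idx l y)\<^sup>2)" for k l
    unfolding psum_add psum_diff power2_eq_square by algebra
  then show ?thesis
    by (simp add: quad_def sum_distrib_left flip: sum.distrib)
qed

text \<open>Replacing two points by the rounded midpoints of their partial sums keeps their sum, and it
  decreases the quadratic form unless the points are adjacent (discrete midpoint convexity).\<close>

lemma adjacent_if_quad_minimal:
  assumes u: "u \<in> grid I q" and u': "u' \<in> grid I q"
    and min: "\<And>w w'. w \<in> grid I q \<Longrightarrow> w' \<in> grid I q \<Longrightarrow> w + w' = u + u' \<Longrightarrow> quad (u - u') \<le> quad (w - w')"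
  shows "adjacent u u'"
proof -
  define P P' where "P k = \<lfloor>psum idx k u\<rfloor>" and "P' k = \<lfloor>psum idx k u'\<rfloor>" for k
  have P: "psum idx k u = of_int (P k)" and P': "psum idx k u' = of_int (P' k)" for k
    using psum_grid(1)[OF u] psum_grid(1)[OF u'] unfolding P_def P'_def by (metis Ints_cases floor_of_int)+
  have P0: "P 0 = 0" "P' 0 = 0"
    using P[of 0] P'[of 0] by (simp_all add: psum_0)
  have Pn: "P k = int q" "P' k = int q" if "n \<le> k" for k
    using P[of k, symmetric] P'[of k, symmetric] u u' unfolding psum_top[OF that]
    by (simp_all add: grid_def)
  have mono: "P k \<le> P (Suc k)" "P' k \<le> P' (Suc k)" for k
    using psum_grid(2)[OF u, of k] psum_grid(2)[OF u', of k] unfolding P P' by simp_all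
  have flat: "P (idx j) = P (idx j - 1)" "P' (idx j) = P' (idx j - 1)" if "j \<notin> I" for j
    using psum_grid(4)[OF u that] psum_grid(4)[OF u' that] unfolding P P' by simp_all
  define f where "f k = (P k + P' k) div 2" for k
  define g where "g k = P k + P' k - f k" for k
  define w where "w = of_psum idx (\<lambda>k. of_int (f k))"
  define w' where "w' = of_psum idx (\<lambda>k. of_int (g k))"
  \<comment> \<open>Rounding down and rounding up half of a monotone sequence both preserve
    monotonicity, constant steps and the ends, so the rounded midpoints stay in the grid.\<close>
  have fg_mono: "f k \<le> f (Suc k)" "g k \<le> g (Suc k)" for k
    using mono[of k] unfolding f_def g_def by linarith+
  have fg_flat: "f (idx j) = f (idx j - 1)" "g (idx j) = g (idx j - 1)" if "j \<notin> I" for j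
    unfolding f_def g_def flat[OF that] by (rule refl)+
  have fg_ends: "f 0 = 0" "g 0 = 0" "f n = int q" "g n = int q"
    using P0 Pn[of n] by (simp_all add: f_def g_def)
  have "w \<in> grid I q" "w' \<in> grid I q"
    unfolding w_def w'_def by (intro of_psum_in_grid; simp add: fg_mono fg_flat fg_ends)+
  moreover have "w + w' = of_psum idx (\<lambda>k. psum idx k (u + u'))"
    by (simp add: w_def w'_def of_psum_add g_def P P' psum_add)
  ultimately have le: "quad (u - u') \<le> quad (w - w')"
    using min by (simp add: of_psum_psum)
  define d where "d k = P k - P' k" for k
  define e where "e k = f k - g k" for k
  have d: "quad (u - u') = of_int (\<Sum>k\<le>n. \<Sum>l\<le>n. (d k - d l)\<^sup>2)"
    by (simp add: quad_def psum_diff P P' d_def)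
  have "psum idx k (w - w') = of_int (e k)" if "k \<le> n" for k
    using that P0 by (simp add: psum_diff w_def w'_def psum_of_psum e_def) (simp add: f_def g_def)
  then have e: "quad (w - w') = of_int (\<Sum>k\<le>n. \<Sum>l\<le>n. (e k - e l)\<^sup>2)"
    by (simp add: quad_def)
  \<comment> \<open>\<open>e k\<close> is minus the parity of \<open>d k\<close>. So where the
    \<open>e\<close> differ, by one, the \<open>d\<close> differ as well, and no squared difference
    grows under rounding. Minimality turns this into equality for every pair.\<close>
  have e01: "e k = 0 \<or> e k = - 1" "even (d k - e k)" for k
    unfolding d_def e_def f_def g_def by presburger+
  have sq: "(e k - e l)\<^sup>2 \<le> (d k - d l)\<^sup>2" for k l
  proof (cases "e k = e l")
    case False
    then have "\<bar>e k - e l\<bar> = 1"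
      using e01(1)[of k] e01(1)[of l] by auto
    moreover have "d k \<noteq> d l"
      using False e01[of k] e01[of l] by (auto simp: even_diff_iff)
    ultimately show ?thesis
      by (simp flip: abs_le_square_iff)
  qed simp
  have "(\<Sum>k\<le>n. \<Sum>l\<le>n. (d k - d l)\<^sup>2) \<le> (\<Sum>k\<le>n. \<Sum>l\<le>n. (e k - e l)\<^sup>2)"
    using le unfolding d e by (simp only: of_int_le_iff)
  then have "(\<Sum>k\<le>n. \<Sum>l\<le>n. (d k - d l)\<^sup>2 - (e k - e l)\<^sup>2) \<le> 0"
    by (simp add: sum_subtractf)
  moreover have "0 \<le> (\<Sum>k\<le>n. \<Sum>l\<le>n. (d k - d l)\<^sup>2 - (e k - e l)\<^sup>2)"
    using sq by (intro sum_nonneg) simp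
  ultimately have "(\<Sum>k\<le>n. \<Sum>l\<le>n. (d k - d l)\<^sup>2 - (e k - e l)\<^sup>2) = 0"
    by simp
  then have "\<forall>k\<in>{..n}. (\<Sum>l\<le>n. (d k - d l)\<^sup>2 - (e k - e l)\<^sup>2) = 0"
    using sq by (subst (asm) sum_nonneg_eq_0_iff) (auto intro!: sum_nonneg)
  then have "\<forall>k\<in>{..n}. \<forall>l\<in>{..n}. (d k - d l)\<^sup>2 - (e k - e l)\<^sup>2 = 0"
    using sq by (subst (asm) sum_nonneg_eq_0_iff) auto
  then have "\<bar>d k - d l\<bar> \<le> 1" if "k \<le> n" "l \<le> n" for k l
  proof -
    have "\<bar>d k - d l\<bar> = \<bar>e k - e l\<bar>"
      using \<open>\<forall>k\<in>{..n}. \<forall>l\<in>{..n}. _ = 0\<close> that by (simp add: power2_eq_iff abs_eq_iff)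
    then show ?thesis
      using e01(1)[of k] e01(1)[of l] by auto
  qed
  moreover have d_top: "d k = 0" if "n \<le> k" for k
    using Pn[OF that] by (simp add: d_def)
  ultimately have dd: "\<bar>d k - d l\<bar> \<le> 1" for k l
    using d_top[of n] by (cases "k \<le> n"; cases "l \<le> n") (metis linear order_refl)+
  have "d 0 = 0"
    using P0 by (simp add: d_def)
  \<comment> \<open>Since \<open>d 0 = 0\<close>, every value is at most one in absolute value, and
    values of both signs would differ by two.\<close>
  have "(\<forall>k. 0 \<le> d k \<and> d k \<le> 1) \<or> (\<forall>k. d k \<le> 0 \<and> - 1 \<le> d k)"
  proof (cases "\<exists>k. d k > 0")
    case True
    then obtain k where "d k > 0"
      by blast
    then have "0 \<le> d l \<and> d l \<le> 1" for l
      using dd[of k l] dd[of l 0] \<open>d 0 = 0\<close> by linarith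
    then show ?thesis
      by blast
  next
    case False
    then show ?thesis
      using dd[of _ 0] \<open>d 0 = 0\<close> by (smt (verit))
  qed
  then show ?thesis
    unfolding adjacent_def P P' d_def by (smt (verit) of_int_le_iff of_int_add of_int_1)
qed

text \<open>Adjacency says that the partial sums form a chain with steps 0 and 1, and partial sums
  of an integral combination are integral.\<close>

lemma pairwise_adjacent_coefficients_integral:
  assumes "finite M" and grid: "\<And>w. w \<in> M \<Longrightarrow> w + \<sigma> \<in> grid I q"
    and adj: "\<And>w w'. w \<in> M \<Longrightarrow> w' \<in> M \<Longrightarrow> adjacent (w + \<sigma>) (w' + \<sigma>)"
    and c: "sum c M \<in> \<int>" "(\<Sum>w\<in>M. c w *\<^sub>R (w + \<sigma>)) \<in> integer_points"
  shows "\<forall>w\<in>M. c w \<in> \<int>"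
proof -
  define f where "f w k = \<lfloor>psum idx k (w + \<sigma>)\<rfloor>" for w k
  have f: "of_int (f w k) = psum idx k (w + \<sigma>)" if "w \<in> M" for w k
    using psum_grid(1)[OF grid[OF that], of k] by (simp add: f_def)
  show ?thesis
  proof (rule chain_coefficients_integral[of M f, OF \<open>finite M\<close>])
    show "inj_on f M"
    proof (rule inj_onI)
      fix w w' assume w: "w \<in> M" "w' \<in> M" and eq: "f w = f w'"
      have "psum idx k (w + \<sigma>) = psum idx k (w' + \<sigma>)" for k
        using f[OF w(1), of k] f[OF w(2), of k] eq by simp
      then have "w + \<sigma> = w' + \<sigma>"
        by (rule psum_inject)
      then show "w = w'"
        by simp
    qed
    fix w w' assume w: "w \<in> M" "w' \<in> M"
    have "f w k \<le> f w' k \<longleftrightarrow> psum idx k (w + \<sigma>) \<le> psum idx k (w' + \<sigma>)"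
      "f w k \<le> f w' k + 1 \<longleftrightarrow> psum idx k (w + \<sigma>) \<le> psum idx k (w' + \<sigma>) + 1"
      "f w' k \<le> f w k \<longleftrightarrow> psum idx k (w' + \<sigma>) \<le> psum idx k (w + \<sigma>)"
      "f w' k \<le> f w k + 1 \<longleftrightarrow> psum idx k (w' + \<sigma>) \<le> psum idx k (w + \<sigma>) + 1" for k
      unfolding f[OF w(1), symmetric] f[OF w(2), symmetric] by linarith+
    then show "(\<forall>k. f w k \<le> f w' k \<and> f w' k \<le> f w k + 1) \<or> (\<forall>k. f w' k \<le> f w k \<and> f w k \<le> f w' k + 1)"
      using adj[OF w] unfolding adjacent_def by simp
  next
    fix k
    have "(\<Sum>w\<in>M. c w * of_int (f w k)) = psum idx k (\<Sum>w\<in>M. c w *\<^sub>R (w + \<sigma>))"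
      by (simp only: psum_sum psum_scaleR f cong: sum.cong)
    then show "(\<Sum>w\<in>M. c w * of_int (f w k)) \<in> \<int>"
      using c(2) by (simp add: psum_in_Ints)
  qed (rule c)
qed

section \<open>Finiteness and decomposition of the lattice points\<close>

lemma finite_grid: "finite (grid I q)"
proof -
  have "grid I q \<subseteq> (\<lambda>f. \<chi> j. real (f j)) ` (UNIV \<rightarrow>\<^sub>E {..q})"
  proof
    fix u assume u: "u \<in> grid I q"
    have "\<exists>m::nat. u $ j = m" for j
    proof -
      have "u $ j \<in> \<int>" "0 \<le> u $ j"
        using u by (auto simp: grid_def integer_points_def)
      then show ?thesis
        by (metis Ints_cases of_int_0_le_iff of_int_of_nat_eq zero_le_imp_eq_int)
    qed
    then obtain f :: "'n \<Rightarrow> nat" where f: "\<And>j. u $ j = f j"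
      by metis
    have "u $ j \<le> (\<Sum>j\<in>UNIV. u $ j)" for j
      using u by (intro member_le_sum) (auto simp: grid_def)
    then have "f j \<le> q" for j
      using u f by (auto simp: grid_def)
    then show "u \<in> (\<lambda>f. \<chi> j. real (f j)) ` (UNIV \<rightarrow>\<^sub>E {..q})"
      using f by (intro image_eqI[of _ _ f]) (auto simp: vec_eq_iff)
  qed
  moreover have "finite ((UNIV :: 'n set) \<rightarrow>\<^sub>E {..q})"
    by (intro finite_PiE) auto
  ultimately show ?thesis
    by (metis finite_imageI finite_subset)
qed

text \<open>The integer decomposition property, by greedy truncation: cutting the partial sums off
  at \<open>q\<close> leaves two monotone sequences, one ending in \<open>q\<close> and the rest one
  dilation lower.\<close>

lemma grid_sum_split:
  assumes "y \<in> grid I (m * q)"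
  shows "\<exists>z. (\<forall>i<m. z i \<in> grid I q) \<and> (\<Sum>i<m. z i) = y"
  using assms
proof (induction m arbitrary: y)
  case 0
  then have "\<forall>j. y $ j = 0"
    by (auto simp: grid_def sum_nonneg_eq_0_iff)
  then show ?case
    by (simp add: vec_eq_iff)
next
  case (Suc m)
  define f where "f k = min (psum idx k y) q" for k
  define z where "z = of_psum idx f"
  note y = psum_grid[OF Suc.prems]
  have "z \<in> grid I q"
    unfolding z_def
  proof (rule of_psum_in_grid)
    show "f k \<le> f (Suc k)" for k
      using y(2)[of k] by (auto simp: f_def)
    show "f k \<in> \<int>" for k
      using y(1)[of k] by (simp add: f_def min_def)
    show "f (idx j) = f (idx j - 1)" if "j \<notin> I" for j
      using y(4)[OF that] by (simp add: f_def)
  qed (use y(3) in \<open>auto simp: f_def psum_0\<close>)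
  moreover have "y - z = of_psum idx (\<lambda>k. psum idx k y - f k)"
    unfolding z_def by (subst (1) of_psum_psum[of y, symmetric]) (simp add: of_psum_def vec_eq_iff)
  then have "y - z \<in> grid I (m * q)"
  proof (elim ssubst, intro of_psum_in_grid)
    show "psum idx k y - f k \<le> psum idx (Suc k) y - f (Suc k)" for k
      using y(2)[of k] by (auto simp: f_def)
    show "psum idx k y - f k \<in> \<int>" for k
      using y(1)[of k] by (simp add: f_def min_def)
    show "psum idx (idx j) y - f (idx j) = psum idx (idx j - 1) y - f (idx j - 1)" if "j \<notin> I" for j
      using y(4)[OF that] by (simp add: f_def)
  qed (use y(3) in \<open>auto simp: f_def psum_0\<close>)
  then obtain z' where "\<forall>i<m. z' i \<in> grid I q" "(\<Sum>i<m. z' i) = y - z"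
    using Suc.IH by blast
  ultimately show ?case
    by (intro exI[of _ "z'(m := z)"]) (auto simp: less_Suc_eq)
qed

text \<open>By the parallelogram law, comparing heights at equal sums means comparing the form at
  differences, where the shift \<open>\<sigma>\<close> cancels. For the competitors an upper bound
  on the height suffices, so a point common to both simplices may have a smaller height.\<close>

lemma adjacent_if_exchange_minimal:
  assumes X: "exchange_minimal N A \<omega> X" and "2 \<le> N"
    and A: "\<And>y. y + \<sigma> \<in> grid I q \<Longrightarrow> y \<in> A \<and> \<omega> y \<le> \<kappa> + quad y"
    and w: "w \<in> X" "w + \<sigma> \<in> grid I q" "\<omega> w = \<kappa> + quad w"
    and w': "w' \<in> X" "w' + \<sigma> \<in> grid I q" "\<omega> w' = \<kappa> + quad w'"
  shows "adjacent (w + \<sigma>) (w' + \<sigma>)"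
proof (rule adjacent_if_quad_minimal[OF w(2) w'(2)])
  fix y y' assume y: "y \<in> grid I q" "y' \<in> grid I q" and eq: "y + y' = w + \<sigma> + (w' + \<sigma>)"
  have sum: "w + w' = (y - \<sigma>) + (y' - \<sigma>)"
    using eq by (simp add: algebra_simps)
  have "\<omega> w + \<omega> w' \<le> \<omega> (y - \<sigma>) + \<omega> (y' - \<sigma>)"
    using A[of "y - \<sigma>"] A[of "y' - \<sigma>"] y sum
    by (intro exchange_minimal_pairD[OF X \<open>2 \<le> N\<close> w(1) w'(1)]) auto
  then have "quad w + quad w' \<le> quad (y - \<sigma>) + quad (y' - \<sigma>)"
    using A[of "y - \<sigma>"] A[of "y' - \<sigma>"] y w(3) w'(3) by auto
  then show "quad (w + \<sigma> - (w' + \<sigma>)) \<le> quad (y - y')"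
    using quad_parallelogram[of w w'] quad_parallelogram[of "y - \<sigma>" "y' - \<sigma>"] sum by simp
qed

section \<open>Two dilated simplices on complementary coordinates\<close>

definition join_config :: "'n set \<Rightarrow> nat \<Rightarrow> real ^ 'n \<Rightarrow> real ^ 'n \<Rightarrow> (real ^ 'n) set" where
  "join_config I q \<sigma> \<tau> = {w. w + \<sigma> \<in> grid I q} \<union> {w. w + \<tau> \<in> grid (- I) q}"

text \<open>\<open>K\<close> is a penalty for points outside the second simplex; a common point of
  both simplices does not pay it.\<close>

definition join_height :: "'n set \<Rightarrow> nat \<Rightarrow> real ^ 'n \<Rightarrow> real \<Rightarrow> real ^ 'n \<Rightarrow> real" where
  "join_height I q \<tau> K w = (if w + \<tau> \<in> grid (- I) q then quad w else K + quad w)"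

lemma join_height_le: "0 \<le> K \<Longrightarrow> join_height I q \<tau> K w \<le> K + quad w"
  by (simp add: join_height_def)

lemma finite_join_config: "finite (join_config I q \<sigma> \<tau>)"
proof -
  have eq: "{w. w + \<sigma> \<in> grid J q} = (\<lambda>u. u - \<sigma>) ` grid J q" for \<sigma> J
    by (auto intro: image_eqI[of _ _ "_ + \<sigma>"])
  show ?thesis
    unfolding join_config_def eq using finite_grid by blast
qed

lemma join_config_integer:
  assumes "\<sigma> \<in> integer_points" "\<tau> \<in> integer_points" "w \<in> join_config I q \<sigma> \<tau>"
  shows "w \<in> integer_points"
proof -
  have "w + \<sigma> \<in> integer_points \<or> w + \<tau> \<in> integer_points"
    using assms(3) by (auto simp: join_config_def grid_def)
  then show ?thesis
    using integer_points_diff[of "w + \<sigma>" \<sigma>] integer_points_diff[of "w + \<tau>" \<tau>] assms(1,2) by auto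
qed

text \<open>The premise \<open>split\<close> is the only interaction between the simplices. Once
  both coefficient sums are integral, the shifts contribute lattice vectors, and the two shifted
  combinations have disjoint supports, so each is integral by itself and the chain argument applies
  to each side.\<close>

proposition unimodular_join_height:
  assumes \<sigma>: "\<sigma> \<in> integer_points" and \<tau>: "\<tau> \<in> integer_points" and K: "0 \<le> K" "K \<in> \<int>" and "2 \<le> N"
    and split: "\<And>X c. \<lbrakk>exchange_minimal N (join_config I q \<sigma> \<tau>) (join_height I q \<tau> K) X;
        sum c X \<in> \<int>; (\<Sum>w\<in>X. c w *\<^sub>R w) \<in> integer_points\<rbrakk>
      \<Longrightarrow> sum c {w \<in> X. w + \<tau> \<notin> grid (- I) q} \<in> \<int>"
  shows "unimodular_height N (join_config I q \<sigma> \<tau>) (join_height I q \<tau> K)"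
proof -
  let ?A = "join_config I q \<sigma> \<tau>" and ?\<omega> = "join_height I q \<tau> K"
  have "primitive X" if X: "exchange_minimal N ?A ?\<omega> X" for X
    unfolding primitive_def
  proof (intro allI impI)
    fix c assume c: "sum c X \<in> \<int>" "(\<Sum>w\<in>X. c w *\<^sub>R w) \<in> integer_points"
    have "X \<subseteq> ?A"
      using X by (simp add: exchange_minimal_def)
    then have finX: "finite X"
      using finite_join_config by (rule finite_subset)
    define U where "U = {w \<in> X. w + \<tau> \<notin> grid (- I) q}"
    define V where "V = {w \<in> X. w + \<tau> \<in> grid (- I) q}"
    have UV: "X = U \<union> V" "U \<inter> V = {}" "finite U" "finite V"
      using finX by (auto simp: U_def V_def)
    have gridU: "w + \<sigma> \<in> grid I q" if "w \<in> U" for w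
      using that \<open>X \<subseteq> ?A\<close> by (auto simp: U_def join_config_def)
    have gridV: "w + \<tau> \<in> grid (- I) q" if "w \<in> V" for w
      using that by (simp add: V_def)
    have sum_UV: "sum g X = sum g U + sum g V" for g :: "real ^ 'n \<Rightarrow> 'b::comm_monoid_add"
      unfolding UV(1) using UV by (intro sum.union_disjoint) auto
    have cU: "sum c U \<in> \<int>"
      unfolding U_def using X c by (rule split)
    then have cV: "sum c V \<in> \<int>"
      using c(1) sum_UV[of c] by (metis Ints_diff add_diff_cancel_left')
    define SU where "SU = (\<Sum>w\<in>U. c w *\<^sub>R (w + \<sigma>))"
    define SV where "SV = (\<Sum>w\<in>V. c w *\<^sub>R (w + \<tau>))"
    have "SU + SV = (\<Sum>w\<in>X. c w *\<^sub>R w) + sum c U *\<^sub>R \<sigma> + sum c V *\<^sub>R \<tau>"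
      by (simp add: SU_def SV_def sum_UV scaleR_add_right sum.distrib scaleR_sum_left)
    then have SUV: "SU + SV \<in> integer_points"
      using c(2) cU cV \<sigma> \<tau> by (simp add: integer_points_add integer_points_scaleR)
    have SU0: "SU $ j = 0" if "j \<notin> I" for j
      using gridU that by (auto simp: SU_def grid_def intro!: sum.neutral)
    have SV0: "SV $ j = 0" if "j \<in> I" for j
      using gridV that by (auto simp: SV_def grid_def intro!: sum.neutral)
    have "SU $ j \<in> \<int> \<and> SV $ j \<in> \<int>" for j
    proof (cases "j \<in> I")
      case True
      then show ?thesis
        using SUV SV0[OF True] by (auto simp: integer_points_def dest: spec[of _ j])
    next
      case False
      then show ?thesis
        using SUV SU0[OF False] by (auto simp: integer_points_def dest: spec[of _ j])
    qed
    then have S: "SU \<in> integer_points" "SV \<in> integer_points"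
      by (simp_all add: integer_points_def)
    have "\<forall>w\<in>U. c w \<in> \<int>"
    proof (rule pairwise_adjacent_coefficients_integral[OF UV(3) gridU])
      show "adjacent (w + \<sigma>) (w' + \<sigma>)" if "w \<in> U" "w' \<in> U" for w w'
        using that gridU
        by (intro adjacent_if_exchange_minimal[OF X \<open>2 \<le> N\<close>, where \<kappa> = K])
          (auto simp: U_def join_config_def join_height_def K)
    qed (use cU S in \<open>simp_all add: SU_def\<close>)
    moreover have "\<forall>w\<in>V. c w \<in> \<int>"
    proof (rule pairwise_adjacent_coefficients_integral[OF UV(4) gridV])
      show "adjacent (w + \<tau>) (w' + \<tau>)" if "w \<in> V" "w' \<in> V" for w w'
      proof (rule adjacent_if_exchange_minimal[OF X \<open>2 \<le> N\<close>, where \<kappa> = 0])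
        show "y \<in> ?A \<and> ?\<omega> y \<le> 0 + quad y" if "y + \<tau> \<in> grid (- I) q" for y
          using that by (simp add: join_config_def join_height_def)
        show "?\<omega> w = 0 + quad w" "?\<omega> w' = 0 + quad w'"
          using gridV[OF that(1)] gridV[OF that(2)] by (simp_all add: join_height_def)
      qed (use that in \<open>simp_all add: V_def\<close>)
    qed (use cV S in \<open>simp_all add: SV_def\<close>)
    ultimately show "\<forall>w\<in>X. c w \<in> \<int>"
      by (auto simp: UV(1))
  qed
  moreover have "?\<omega> ` ?A \<subseteq> \<int>"
    using join_config_integer[OF \<sigma> \<tau>] K by (auto simp: join_height_def quad_in_Ints)
  ultimately show ?thesis
    unfolding unimodular_height_def using finite_join_config join_config_integer[OF \<sigma> \<tau>] by blast
qed

text \<open>The components of \<open>u\<close>, divided by \<open>q\<close>, are its barycentric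
  coordinates.\<close>

lemma grid_subset_convex_hull:
  assumes u: "u \<in> grid I q" and "0 < q" and C: "\<And>j. j \<in> I \<Longrightarrow> real q *\<^sub>R axis j 1 - \<sigma> \<in> convex hull C"
  shows "u - \<sigma> \<in> convex hull C"
proof -
  have "(\<Sum>j\<in>I. u $ j) = (\<Sum>j\<in>UNIV. u $ j)"
    using u by (intro sum.mono_neutral_left) (auto simp: grid_def)
  then have total: "(\<Sum>j\<in>I. u $ j / q) = 1"
    using u \<open>0 < q\<close> by (simp add: grid_def flip: sum_divide_distrib)
  have "(\<Sum>j\<in>I. (u $ j / q) *\<^sub>R (real q *\<^sub>R axis j 1 - \<sigma>)) = (\<Sum>j\<in>I. u $ j *\<^sub>R axis j 1) - (\<Sum>j\<in>I. u $ j / q) *\<^sub>R \<sigma>"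
    using \<open>0 < q\<close> by (simp add: scaleR_diff_right sum_subtractf scaleR_sum_left)
  also have "(\<Sum>j\<in>I. u $ j *\<^sub>R axis j 1) = (\<Sum>j\<in>UNIV. u $ j *\<^sub>R axis j 1)"
    using u by (intro sum.mono_neutral_left) (auto simp: grid_def)
  also have "\<dots> = u"
    using basis_expansion[of u] by (simp add: scalar_mult_eq_scaleR)
  finally have "u - \<sigma> = (\<Sum>j\<in>I. (u $ j / q) *\<^sub>R (real q *\<^sub>R axis j 1 - \<sigma>))"
    by (simp add: total)
  also have "\<dots> \<in> convex hull C"
    using total u C by (intro convex_sum) (auto simp: grid_def)
  finally show ?thesis .
qed

lemma axis_in_grid: "j \<in> I \<Longrightarrow> real q *\<^sub>R axis j 1 \<in> grid I q"
  by (auto simp: grid_def integer_points_def axis_def if_distrib cong: if_cong)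

lemma convex_hull_join_config:
  assumes "0 < q"
  shows "convex hull (join_config I q \<sigma> \<tau>)
    = convex hull (range (\<lambda>j. real q *\<^sub>R axis j 1 - (if j \<in> I then \<sigma> else \<tau>)))" (is "_ = convex hull ?C")
proof (intro antisym hull_minimal subsetI)
  fix w assume "w \<in> join_config I q \<sigma> \<tau>"
  then consider "w + \<sigma> \<in> grid I q" | "w + \<tau> \<in> grid (- I) q"
    by (auto simp: join_config_def)
  then show "w \<in> convex hull ?C"
  proof cases
    case 1
    have "real q *\<^sub>R axis j 1 - \<sigma> \<in> convex hull ?C" if "j \<in> I" for j
      using that by (intro hull_inc) (auto intro: image_eqI[of _ _ j])
    then show ?thesis
      using grid_subset_convex_hull[OF 1 assms, of \<sigma>] by simp
  next
    case 2
    have "real q *\<^sub>R axis j 1 - \<tau> \<in> convex hull ?C" if "j \<in> - I" for j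
      using that by (intro hull_inc) (auto intro: image_eqI[of _ _ j])
    then show ?thesis
      using grid_subset_convex_hull[OF 2 assms, of \<tau>] by simp
  qed
next
  fix w assume "w \<in> ?C"
  then have "w \<in> join_config I q \<sigma> \<tau>"
    using axis_in_grid by (auto simp: join_config_def)
  then show "w \<in> convex hull (join_config I q \<sigma> \<tau>)"
    by (rule hull_inc)
qed auto

text \<open>For odd dimension the two dilated simplices lie in parallel subspaces at lattice distance one.\<close>

proposition unimodular_join_height_odd:
  fixes I :: "'n set" and s :: "real ^ 'n"
  assumes s: "s = (\<chi> j. if j \<in> I then 1 else - 1)"
    and card: "odd q" "2 * card I = q + 1 \<or> 2 * card I + 1 = q"
  shows "unimodular_height 2 (join_config I q s (- s)) (join_height I q (- s) 0)"
proof (rule unimodular_join_height)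
  show "s \<in> integer_points" "- s \<in> integer_points"
    by (auto simp: s integer_points_def)
  fix X c
  assume X: "exchange_minimal 2 (join_config I q s (- s)) (join_height I q (- s) 0) X"
    and c: "sum c X \<in> \<int>" "(\<Sum>w\<in>X. c w *\<^sub>R w) \<in> integer_points"
  let ?U = "{w \<in> X. w + - s \<notin> grid (- I) q}" and ?V = "{w \<in> X. w + - s \<in> grid (- I) q}"
  have XA: "X \<subseteq> join_config I q s (- s)"
    using X by (simp add: exchange_minimal_def)
  then have finX: "finite X"
    using finite_join_config by (rule finite_subset)
  have sum_UV: "sum g X = sum g ?U + sum g ?V" for g :: "real ^ 'n \<Rightarrow> real"
  proof -
    have "sum g (?U \<union> ?V) = sum g ?U + sum g ?V"
      using finX by (intro sum.union_disjoint) auto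
    moreover have "?U \<union> ?V = X"
      by blast
    ultimately show ?thesis
      by metis
  qed
  \<comment> \<open>The coordinate sum over \<open>I\<close> is the functional that separates the
    simplices: its values are \<open>q - card I\<close> here and \<open>card I\<close> on the other
    one, which differ by one.\<close>
  have compU: "(\<Sum>j\<in>I. w $ j) = real q - card I" if "w \<in> ?U" for w
  proof -
    have w: "w + s \<in> grid I q"
      using that XA by (auto simp: join_config_def)
    have "(\<Sum>j\<in>I. (w + s) $ j) = (\<Sum>j\<in>UNIV. (w + s) $ j)"
      using w by (intro sum.mono_neutral_left) (auto simp: grid_def)
    also have "\<dots> = q"
      using w by (simp add: grid_def)
    finally show ?thesis
      by (simp add: s sum.distrib)
  qed
  have compV: "(\<Sum>j\<in>I. w $ j) = card I" if "w \<in> ?V" for w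
  proof -
    have "\<forall>j\<in>I. (w + - s) $ j = 0"
      using that by (auto simp: grid_def)
    then show ?thesis
      by (simp add: s)
  qed
  define a where "a = sum c ?U"
  define b where "b = sum c ?V"
  have "(\<Sum>j\<in>I. (\<Sum>w\<in>X. c w *\<^sub>R w) $ j) = (\<Sum>w\<in>X. c w * (\<Sum>j\<in>I. w $ j))"
    by (simp add: sum_distrib_left) (rule sum.swap)
  also have "\<dots> = a * (real q - card I) + b * card I"
    unfolding sum_UV a_def b_def sum_distrib_right using compU compV by (intro arg_cong2[of _ _ _ _ "(+)"] sum.cong) auto
  finally have "a * (real q - card I) + b * card I \<in> \<int>"
    using c(2) by (metis (no_types, lifting) Ints_sum integer_points_def mem_Collect_eq)
  moreover have "a + b \<in> \<int>"
    using c(1) sum_UV[of c] by (simp add: a_def b_def)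
  ultimately obtain k l where kl: "a * (real q - card I) + b * card I = of_int k" "a + b = of_int l"
    by (metis Ints_cases)
  have b: "b = of_int l - a"
    using kl(2) by linarith
  have "a * (real q - 2 * card I) = of_int (k - l * int (card I))"
    using kl(1) unfolding b by (simp add: algebra_simps)
  moreover have "real q - 2 * card I = 1 \<or> real q - 2 * card I = - 1"
    using card(2) by auto
  ultimately have "a = of_int (k - l * int (card I)) \<or> a = - of_int (k - l * int (card I))"
    by auto
  then show "sum c ?U \<in> \<int>"
    unfolding a_def[symmetric] by (auto simp del: of_int_diff of_int_mult)
qed auto

text \<open>For even dimension the two dilated simplices share the origin as a relative interior point.
  The penalty K forces the part of a contact set in the first simplex into one of its facets.\<close>

proposition unimodular_join_height_even:
  fixes I :: "'n set"
  assumes "0 < q" "card I = q" "card (- I) = q"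
  shows "\<exists>N\<ge>2. \<exists>\<omega>. unimodular_height N
    (join_config I q (\<chi> j. if j \<in> I then 1 else 0) (\<chi> j. if j \<in> I then 0 else 1)) \<omega>"
proof -
  define \<sigma> :: "real ^ 'n" where "\<sigma> = (\<chi> j. if j \<in> I then 1 else 0)"
  define \<tau> :: "real ^ 'n" where "\<tau> = (\<chi> j. if j \<in> I then 0 else 1)"
  have int: "\<sigma> \<in> integer_points" "\<tau> \<in> integer_points"
    by (auto simp: \<sigma>_def \<tau>_def integer_points_def)
  let ?A = "join_config I q \<sigma> \<tau>"
  \<comment> \<open>The exchange below involves all points of \<open>U\<close> at once, hence up to
    \<open>card ?A\<close> of them; the adjacency argument needs pairs.\<close>
  define N where "N = max 2 (card ?A)"
  define \<Phi> where "\<Phi> = (\<Sum>w\<in>?A. quad w)"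
  \<comment> \<open>One saved penalty outweighs \<open>N\<close> values of the quadratic
    form.\<close>
  define K where "K = real N * \<Phi> + 1"
  have quad_le: "quad w \<le> \<Phi>" if "w \<in> ?A" for w
    unfolding \<Phi>_def using that finite_join_config quad_nonneg by (intro member_le_sum) auto
  have "0 \<le> \<Phi>" "\<Phi> \<in> \<int>"
    using quad_nonneg quad_in_Ints join_config_integer[OF int] by (auto simp: \<Phi>_def intro: sum_nonneg Ints_sum)
  then have K: "0 \<le> K" "K \<in> \<int>"
    by (simp_all add: K_def)
  let ?\<omega> = "join_height I q \<tau> K"
  have "unimodular_height N ?A ?\<omega>"
  proof (rule unimodular_join_height[OF int K])
    fix X c
    assume X: "exchange_minimal N ?A ?\<omega> X" and c: "sum c X \<in> \<int>" "(\<Sum>w\<in>X. c w *\<^sub>R w) \<in> integer_points"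
    define U where "U = {w \<in> X. w + \<tau> \<notin> grid (- I) q}"
    have XA: "X \<subseteq> ?A"
      using X by (simp add: exchange_minimal_def)
    then have finX: "finite X" and finU: "finite U"
      using finite_join_config by (auto simp: U_def intro: finite_subset)
    have gridU: "w + \<sigma> \<in> grid I q" if "w \<in> U" for w
      using that XA by (auto simp: U_def join_config_def)
    have "\<exists>i\<in>I. \<forall>w\<in>U. (w + \<sigma>) $ i = 0"
    proof (rule ccontr)
      assume contra: "\<not> (\<exists>i\<in>I. \<forall>w\<in>U. (w + \<sigma>) $ i = 0)"
      \<comment> \<open>If every coordinate in \<open>I\<close> were positive somewhere on
        \<open>U\<close>, one copy of \<open>\<sigma>\<close> could be taken off the shifted sum.
        The rest splits into one grid point fewer, so the points of \<open>U\<close> could be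
        exchanged for \<open>m\<close> points of the first simplex and the origin, which saves one
        penalty.\<close>
      define y where "y = (\<Sum>w\<in>U. w + \<sigma>) - \<sigma>"
      have ge1: "1 \<le> (\<Sum>w\<in>U. (w + \<sigma>) $ i)" if "i \<in> I" for i
      proof -
        obtain w where w: "w \<in> U" "(w + \<sigma>) $ i \<noteq> 0"
          using contra \<open>i \<in> I\<close> by blast
        have "(w + \<sigma>) $ i \<in> \<int>" "0 \<le> (w + \<sigma>) $ i"
          using gridU[OF w(1)] by (auto simp: grid_def integer_points_def)
        then have "1 \<le> (w + \<sigma>) $ i"
          using w(2) by (elim Ints_cases) auto
        also have "\<dots> \<le> (\<Sum>w\<in>U. (w + \<sigma>) $ i)"
          using w(1) finU gridU by (intro member_le_sum) (auto simp: grid_def)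
        finally show ?thesis .
      qed
      have "I \<noteq> {}"
        using assms(1,2) by auto
      then have "U \<noteq> {}"
        using ge1 by force
      then obtain m where m: "card U = Suc m"
        using finU by (metis card_eq_0_iff not0_implies_Suc)
      have "y \<in> grid I (m * q)"
        unfolding grid_def
      proof (intro CollectI conjI allI impI)
        show "y \<in> integer_points"
          using gridU int(1) unfolding y_def
          by (intro integer_points_diff) (auto simp: integer_points_def grid_def intro!: Ints_sum)
        show "0 \<le> y $ j" for j
          using ge1[of j] gridU by (cases "j \<in> I") (auto simp: y_def \<sigma>_def grid_def intro!: sum_nonneg)
        show "y $ j = 0" if "j \<notin> I" for j
          using that gridU by (auto simp: y_def \<sigma>_def grid_def intro!: sum.neutral)
        have "(\<Sum>j\<in>UNIV. y $ j) = (\<Sum>w\<in>U. \<Sum>j\<in>UNIV. (w + \<sigma>) $ j) - (\<Sum>j\<in>UNIV. \<sigma> $ j)"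
          unfolding y_def vector_minus_component sum_component sum_subtractf by (subst sum.swap) (rule refl)
        also have "(\<Sum>w\<in>U. \<Sum>j\<in>UNIV. (w + \<sigma>) $ j) = (\<Sum>w\<in>U. real q)"
          using gridU by (intro sum.cong) (auto simp: grid_def)
        also have "(\<Sum>j\<in>UNIV. \<sigma> $ j) = card I"
          by (simp add: \<sigma>_def flip: sum.inter_filter)
        finally show "(\<Sum>j\<in>UNIV. y $ j) = real (m * q)"
          by (simp add: m assms(2) algebra_simps)
      qed
      then obtain z where z: "\<And>i. i < m \<Longrightarrow> z i \<in> grid I q" "(\<Sum>i<m. z i) = y"
        using grid_sum_split by metis
      obtain x where x: "bij_betw x {..<Suc m} U"
        using finU m by (metis atLeast0LessThan ex_bij_betw_nat_finite)
      define y' where "y' i = (if i < m then z i - \<sigma> else 0)" for i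
      \<comment> \<open>The origin also lies in the second simplex, because
        \<open>card (- I) = q\<close>; so it pays no penalty.\<close>
      have "0 + \<tau> \<in> grid (- I) q"
        using assms(3) by (auto simp: grid_def \<tau>_def integer_points_def sum.If_cases Compl_eq)
      then have origin: "0 \<in> ?A" "?\<omega> 0 = 0"
        by (auto simp: join_config_def join_height_def quad_0)
      have y'A: "y' i \<in> ?A" if "i < Suc m" for i
        using z(1)[of i] origin by (auto simp: y'_def join_config_def)
      have "(\<Sum>i<Suc m. x i) = (\<Sum>w\<in>U. w)"
        by (rule sum.reindex_bij_betw[OF x])
      also have "\<dots> = (\<Sum>i<Suc m. y' i)"
        using z(2) by (simp add: y'_def y_def sum_subtractf sum.distrib m scaleR_left_distrib algebra_simps
            sum_constant_scaleR)
      finally have sum_eq: "(\<Sum>i<Suc m. x i) = (\<Sum>i<Suc m. y' i)" .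
      have "U \<subseteq> ?A"
        using XA by (auto simp: U_def)
      then have "card U \<le> card ?A"
        using finite_join_config by (rule card_mono[rotated])
      then have mN: "Suc m \<le> N"
        using m by (simp add: N_def)
      have "real (Suc m) * K \<le> (\<Sum>i<Suc m. ?\<omega> (x i))"
      proof -
        have "K \<le> ?\<omega> (x i)" if "i < Suc m" for i
          using bij_betwE[OF x] that quad_nonneg[of "x i"] by (auto simp: U_def join_height_def)
        then have "(\<Sum>i<Suc m. K) \<le> (\<Sum>i<Suc m. ?\<omega> (x i))"
          by (intro sum_mono) auto
        then show ?thesis
          by simp
      qed
      also have "\<dots> \<le> (\<Sum>i<Suc m. ?\<omega> (y' i))"
        using bij_betwE[OF x] y'A by (intro exchange_minimalD[OF X mN _ _ sum_eq]) (auto simp: U_def)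
      also have "\<dots> = (\<Sum>i<m. ?\<omega> (y' i))"
        using origin(2) by (simp add: y'_def)
      also have "\<dots> \<le> (\<Sum>i<m. K + \<Phi>)"
        using quad_le[OF y'A] join_height_le[OF K(1)] by (intro sum_mono) (meson add_left_mono lessThan_iff less_SucI order_trans)
      finally have "K \<le> real m * \<Phi>"
        by (simp add: algebra_simps)
      also have "\<dots> \<le> real N * \<Phi>"
        using mN \<open>0 \<le> \<Phi>\<close> by (intro mult_right_mono) auto
      finally show False
        by (simp add: K_def)
    qed
    then obtain i where i: "i \<in> I" "\<And>w. w \<in> U \<Longrightarrow> (w + \<sigma>) $ i = 0"
      by blast
    \<comment> \<open>On a facet of the first simplex the coordinate \<open>i\<close> is -1, and on
      the second simplex it is 0, so this coordinate of the combination reads off the coefficient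
      sum of \<open>U\<close>.\<close>
    have "w $ i = (if w \<in> U then - 1 else 0)" if "w \<in> X" for w
      using that i by (auto simp: U_def \<sigma>_def \<tau>_def grid_def add_eq_0_iff)
    then have "(\<Sum>w\<in>X. c w *\<^sub>R w) $ i = (\<Sum>w\<in>X. if w \<in> U then - c w else 0)"
      unfolding sum_component by (intro sum.cong) auto
    also have "\<dots> = - sum c U"
      using finX by (simp add: U_def sum_negf flip: sum.inter_filter)
    finally have "(\<Sum>w\<in>X. c w *\<^sub>R w) $ i = - sum c U" .
    then have "- sum c U \<in> \<int>"
      using c(2) by (metis (mono_tags, lifting) integer_points_def mem_Collect_eq)
    then show "sum c {w \<in> X. w + \<tau> \<notin> grid (- I) q} \<in> \<int>"
      by (simp add: U_def)
  qed (simp add: N_def)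
  then show ?thesis
    unfolding \<sigma>_def \<tau>_def by (intro exI[of _ N]) (auto simp: N_def)
qed

end

section \<open>The Laplacian of the boundary of a simplex\<close>

lemma nth_vertex_bij:
  assumes "finite \<sigma>"
  shows "bij_betw (nth_vertex \<sigma>) {1..card \<sigma>} \<sigma>"
    and "k \<in> {1..card \<sigma>} \<Longrightarrow> card {x \<in> \<sigma>. x < nth_vertex \<sigma> k} = k - 1"
proof -
  define xs where "xs = sorted_list_of_set \<sigma>"
  have xs: "set xs = \<sigma>" "length xs = card \<sigma>" "distinct xs" "sorted_wrt (<) xs"
    using assms by (auto simp: xs_def)
  have "bij_betw (\<lambda>k. k - 1) {1..card \<sigma>} {..<card \<sigma>}"
    by (rule bij_betwI[of _ _ _ Suc]) auto
  moreover have "bij_betw ((!) xs) {..<card \<sigma>} \<sigma>"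
    by (rule bij_betw_nth) (simp_all add: xs)
  ultimately have "bij_betw ((!) xs \<circ> (\<lambda>k. k - 1)) {1..card \<sigma>} \<sigma>"
    by (rule bij_betw_trans)
  then show "bij_betw (nth_vertex \<sigma>) {1..card \<sigma>} \<sigma>"
    by (simp add: nth_vertex_def[abs_def] xs_def o_def)
  have less: "xs ! i < xs ! j \<longleftrightarrow> i < j" if "i < length xs" "j < length xs" for i j
    using sorted_wrt_nth_less[OF xs(4)] that by (metis less_asym linorder_neqE_nat)
  assume k: "k \<in> {1..card \<sigma>}"
  have "{x \<in> \<sigma>. x < xs ! (k - 1)} = (!) xs ` {..<k - 1}"
  proof (intro equalityI subsetI)
    fix x assume x: "x \<in> {x \<in> \<sigma>. x < xs ! (k - 1)}"
    then obtain i where "i < length xs" "x = xs ! i"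
      using xs(1) by (metis (no_types, lifting) in_set_conv_nth mem_Collect_eq)
    then show "x \<in> (!) xs ` {..<k - 1}"
      using x k less[of i "k - 1"] xs(2) by auto
  next
    fix x assume "x \<in> (!) xs ` {..<k - 1}"
    then show "x \<in> {x \<in> \<sigma>. x < xs ! (k - 1)}"
      using k less xs(1,2) nth_mem by fastforce
  qed
  moreover have "inj_on ((!) xs) {..<k - 1}"
    using k xs by (auto simp: inj_on_def nth_eq_iff_index_eq)
  ultimately show "card {x \<in> \<sigma>. x < nth_vertex \<sigma> k} = k - 1"
    by (simp add: nth_vertex_def card_image flip: xs_def)
qed

text \<open>For the k-th smallest vertex of the face this is the sign (-1)^(k-1). Indexing by
  vertices instead of positions lets the boundary be summed over the face itself.\<close>

definition vertex_sign :: "nat set \<Rightarrow> nat \<Rightarrow> rat" where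
  "vertex_sign \<sigma> w = (- 1) ^ card {x \<in> \<sigma>. x < w}"

lemma boundary_matrix_eq:
  assumes "finite (faces \<Delta> i)" "\<sigma> \<in> faces \<Delta> i" "\<tau> \<in> faces \<Delta> (i - 1)"
  shows "boundary_matrix \<Delta> i \<tau> \<sigma> = (\<Sum>w\<in>\<sigma>. vertex_sign \<sigma> w * basis_chain (\<sigma> - {w}) \<tau>)"
proof -
  have fin: "finite \<sigma>"
    using assms(2) by (simp add: faces_def)
  have "boundary_matrix \<Delta> i \<tau> \<sigma>
      = (\<Sum>k=1..card \<sigma>. (- 1) ^ (k - 1) * basis_chain (\<sigma> - {nth_vertex \<sigma> k}) \<tau>)"
    using assms by (simp add: boundary_matrix_def boundary_map_def basis_chain_def[of \<sigma>] of_bool_def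
        if_distrib[of "\<lambda>t. t * _"] cong: if_cong)
  also have "\<dots> = (\<Sum>k=1..card \<sigma>. vertex_sign \<sigma> (nth_vertex \<sigma> k) * basis_chain (\<sigma> - {nth_vertex \<sigma> k}) \<tau>)"
    using nth_vertex_bij(2)[OF fin] by (intro sum.cong) (auto simp: vertex_sign_def)
  also have "\<dots> = (\<Sum>w\<in>\<sigma>. vertex_sign \<sigma> w * basis_chain (\<sigma> - {w}) \<tau>)"
    by (rule sum.reindex_bij_betw[OF nth_vertex_bij(1)[OF fin]])
  finally show ?thesis .
qed

section \<open>Facets and ridges\<close>

lemma finite_faces_boundary_simplex: "finite (faces (boundary_simplex d) i)"
proof -
  have "faces (boundary_simplex d) i \<subseteq> Pow {1..d + 2}"
    unfolding faces_def boundary_simplex_def full_simplex_def by blast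
  then show ?thesis
    by (rule finite_subset) simp
qed

lemma mem_faces_boundary_simplex:
  assumes "\<sigma> \<subset> {1..d + 2}" "int (card \<sigma>) = i + 1" "0 \<le> i"
  shows "\<sigma> \<in> faces (boundary_simplex d) i"
  using assms finite_subset[of \<sigma> "{1..d + 2}"]
  unfolding faces_def boundary_simplex_def full_simplex_def by blast

lemma facet_in_faces:
  assumes "v \<in> {1..d + 2}"
  shows "{1..d + 2} - {v} \<in> faces (boundary_simplex d) (int d)"
proof (rule mem_faces_boundary_simplex)
  show "{1..d + 2} - {v} \<subset> {1..d + 2}"
    using assms by blast
qed (use assms in simp_all)

lemma ridge_in_faces:
  assumes "v \<in> {1..d + 2}" "w \<in> {1..d + 2} - {v}" "0 < d"
  shows "{1..d + 2} - {v} - {w} \<in> faces (boundary_simplex d) (int d - 1)"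
proof (rule mem_faces_boundary_simplex)
  show "{1..d + 2} - {v} - {w} \<subset> {1..d + 2}"
    using assms by blast
qed (use assms in simp_all)

lemma faces_above_dim: "faces (boundary_simplex d) (int d + 1) = {}"
proof -
  have "\<sigma> \<notin> faces (boundary_simplex d) (int d + 1)" for \<sigma>
  proof
    assume "\<sigma> \<in> faces (boundary_simplex d) (int d + 1)"
    then have "\<sigma> \<subseteq> {1..d + 2}" "\<sigma> \<noteq> {1..d + 2}" "int (card \<sigma>) = int d + 1 + 1"
      unfolding faces_def boundary_simplex_def full_simplex_def by blast+
    moreover from this have "card \<sigma> = d + 2"
      by linarith
    ultimately show False
      using card_subset_eq[OF finite_atLeastAtMost, of \<sigma> 1 "d + 2"] by simp
  qed
  then show ?thesis
    by blast
qed

text \<open>Below \<open>v\<close> there are v - 2 vertices left, as \<open>u\<close> is missing,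
  and below \<open>u\<close> there are u - 1; the total exponent is u + v - 3.\<close>

lemma vertex_sign_facet_product:
  assumes "u \<in> {1..n}" "v \<in> {1..n}" "u < v"
  shows "vertex_sign ({1..n} - {u}) v * vertex_sign ({1..n} - {v}) u = - ((- 1) ^ (u + v))"
proof -
  have sets: "{x \<in> {1..n} - {u}. x < v} = {1..<v} - {u}" "{x \<in> {1..n} - {v}. x < u} = {1..<u}"
    using assms by auto
  have cards: "card ({1..<v} - {u}) = v - 2" "card {1..<u} = u - 1"
    using assms by simp_all
  have "vertex_sign ({1..n} - {u}) v * vertex_sign ({1..n} - {v}) u = (- 1) ^ (v - 2 + (u - 1))"
    unfolding vertex_sign_def sets cards power_add ..
  moreover have "u + v = Suc (v - 2 + (u - 1)) + 2"
    using assms by auto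
  ultimately show ?thesis
    by simp
qed

text \<open>In top dimension only the term through the ridges survives. Distinct facets share just
  the ridge that misses both vertices, which gives one product of signs; on the diagonal each of the
  d + 1 ridges contributes a squared sign. For \<open>d = 0\<close> the ridge would be the empty
  face, which carries no chain.\<close>

lemma laplacian_facets:
  assumes u: "u \<in> {1..d + 2}" and v: "v \<in> {1..d + 2}" and "0 < d"
  shows "laplacian (boundary_simplex d) (int d) ({1..d + 2} - {u}) ({1..d + 2} - {v})
    = (if u = v then of_nat d + 1 else - ((- 1) ^ (u + v)))"
proof -
  let ?F = "\<lambda>v. {1..d + 2} - {v}" and ?\<Delta> = "boundary_simplex d"
  have M: "boundary_matrix ?\<Delta> (int d) \<tau> (?F v) = (\<Sum>w\<in>?F v. vertex_sign (?F v) w * basis_chain (?F v - {w}) \<tau>)"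
    if "v \<in> {1..d + 2}" "\<tau> \<in> faces ?\<Delta> (int d - 1)" for v \<tau>
    using finite_faces_boundary_simplex facet_in_faces[OF that(1)] that(2) by (rule boundary_matrix_eq)
  have "laplacian ?\<Delta> (int d) (?F u) (?F v)
    = (\<Sum>\<tau>\<in>faces ?\<Delta> (int d - 1). boundary_matrix ?\<Delta> (int d) \<tau> (?F u) * boundary_matrix ?\<Delta> (int d) \<tau> (?F v))"
    by (simp add: laplacian_def faces_above_dim)
  also have "\<dots> = (\<Sum>\<tau>\<in>faces ?\<Delta> (int d - 1). \<Sum>w\<in>?F u.
      vertex_sign (?F u) w * basis_chain (?F u - {w}) \<tau> * boundary_matrix ?\<Delta> (int d) \<tau> (?F v))"
    using M[OF u] by (intro sum.cong) (simp_all add: sum_distrib_right)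
  also have "\<dots> = (\<Sum>w\<in>?F u. \<Sum>\<tau>\<in>faces ?\<Delta> (int d - 1).
      vertex_sign (?F u) w * basis_chain (?F u - {w}) \<tau> * boundary_matrix ?\<Delta> (int d) \<tau> (?F v))"
    by (rule sum.swap)
  also have "\<dots> = (\<Sum>w\<in>?F u. vertex_sign (?F u) w * boundary_matrix ?\<Delta> (int d) (?F u - {w}) (?F v))"
  proof (intro sum.cong refl)
    fix w assume "w \<in> ?F u"
    then have "?F u - {w} \<in> faces ?\<Delta> (int d - 1)"
      using u \<open>0 < d\<close> by (intro ridge_in_faces)
    then have "(\<Sum>\<tau>\<in>faces ?\<Delta> (int d - 1). if \<tau> = ?F u - {w}
        then vertex_sign (?F u) w * boundary_matrix ?\<Delta> (int d) \<tau> (?F v) else 0)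
      = vertex_sign (?F u) w * boundary_matrix ?\<Delta> (int d) (?F u - {w}) (?F v)"
      using finite_faces_boundary_simplex by (subst sum.delta) auto
    then show "(\<Sum>\<tau>\<in>faces ?\<Delta> (int d - 1).
        vertex_sign (?F u) w * basis_chain (?F u - {w}) \<tau> * boundary_matrix ?\<Delta> (int d) \<tau> (?F v))
      = vertex_sign (?F u) w * boundary_matrix ?\<Delta> (int d) (?F u - {w}) (?F v)"
      by (simp add: basis_chain_def if_distrib if_distribR cong: if_cong)
  qed
  also have "\<dots> = (\<Sum>w\<in>?F u. vertex_sign (?F u) w *
      (\<Sum>w'\<in>?F v. if ?F u - {w} = ?F v - {w'} then vertex_sign (?F v) w' else 0))"
    using M[OF v] ridge_in_faces[OF u _ \<open>0 < d\<close>]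
    by (intro sum.cong) (simp_all add: basis_chain_def if_distrib cong: if_cong)
  also have "\<dots> = (if u = v then of_nat d + 1 else - ((- 1) ^ (u + v)))"
  proof (cases "u = v")
    case True
    have "(\<Sum>w'\<in>?F v. if ?F u - {w} = ?F v - {w'} then vertex_sign (?F v) w' else 0) = vertex_sign (?F u) w"
      if "w \<in> ?F u" for w
    proof -
      have eq: "?F u - {w} = ?F v - {w'} \<longleftrightarrow> w' = w" if "w' \<in> ?F v" for w'
        using that \<open>w \<in> ?F u\<close> True by blast
      have "(\<Sum>w'\<in>?F v. if ?F u - {w} = ?F v - {w'} then vertex_sign (?F v) w' else 0)
          = (\<Sum>w'\<in>?F v. if w' = w then vertex_sign (?F v) w' else 0)"
        by (intro sum.cong refl if_cong eq)
      then show ?thesis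
        using that True by simp
    qed
    then have "(\<Sum>w\<in>?F u. vertex_sign (?F u) w *
      (\<Sum>w'\<in>?F v. if ?F u - {w} = ?F v - {w'} then vertex_sign (?F v) w' else 0)) = (\<Sum>w\<in>?F u. 1)"
      by (intro sum.cong) (auto simp: vertex_sign_def simp flip: power_add)
    also have "\<dots> = of_nat d + 1"
      using u by simp
    finally show ?thesis
      using True by simp
  next
    case False
    have eq: "?F u - {w} = ?F v - {w'} \<longleftrightarrow> w = v \<and> w' = u" if "w \<in> ?F u" "w' \<in> ?F v" for w w'
      using that u v False by blast
    have "(\<Sum>w\<in>?F u. vertex_sign (?F u) w *
        (\<Sum>w'\<in>?F v. if ?F u - {w} = ?F v - {w'} then vertex_sign (?F v) w' else 0))
      = (\<Sum>w\<in>?F u. if w = v then vertex_sign (?F u) v * (\<Sum>w'\<in>?F v. if w' = u then vertex_sign (?F v) w' else 0) else 0)"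
    proof (intro sum.cong refl)
      fix w assume w: "w \<in> ?F u"
      have "(\<Sum>w'\<in>?F v. if ?F u - {w} = ?F v - {w'} then vertex_sign (?F v) w' else 0)
          = (\<Sum>w'\<in>?F v. if w = v \<and> w' = u then vertex_sign (?F v) w' else 0)"
        by (intro sum.cong refl if_cong eq[OF w])
      then show "vertex_sign (?F u) w * (\<Sum>w'\<in>?F v. if ?F u - {w} = ?F v - {w'} then vertex_sign (?F v) w' else 0)
        = (if w = v then vertex_sign (?F u) v * (\<Sum>w'\<in>?F v. if w' = u then vertex_sign (?F v) w' else 0) else 0)"
        by (cases "w = v") simp_all
    qed
    also have "\<dots> = vertex_sign (?F u) v * vertex_sign (?F v) u"
      using u v False by simp
    also have "\<dots> = - ((- 1) ^ (u + v))"
      using vertex_sign_facet_product[OF u v] vertex_sign_facet_product[OF v u] False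
      by (cases "u < v") (auto simp: mult.commute add.commute)
    finally show ?thesis
      using False by simp
  qed
  finally show ?thesis .
qed

text \<open>The reversal of the facet order does not change the parity of a sum of two indices, so
  the matrix is (d + 2) times the identity minus the outer product of \<open>s\<close> with
  itself.\<close>

lemma laplacian_polytope_eq:
  fixes idx :: "'n::finite \<Rightarrow> nat"
  assumes idx: "bij_betw idx UNIV {1..d + 2}" and "0 < d"
  defines "s \<equiv> (\<chi> j. if j \<in> {j. even (idx j)} then 1 else - 1) :: real ^ 'n"
  shows "laplacian_polytope idx d
    = convex hull range (\<lambda>j. real (d + 2) *\<^sub>R axis j 1 - (if j \<in> {j. even (idx j)} then s else - s))"
proof -
  have entry: "laplacian_matrix idx d $ i $ j = (if i = j then real (d + 2) else 0) - s $ i * s $ j" for i j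
  proof -
    have ij: "idx i \<in> {1..d + 2}" "idx j \<in> {1..d + 2}"
      using idx_range[OF idx] by (simp_all only: atLeastAtMost_iff simp_thms)
    let ?u = "d + 3 - idx i" and ?v = "d + 3 - idx j"
    have uv: "?u \<in> {1..d + 2}" "?v \<in> {1..d + 2}"
      using ij by auto
    have eq: "?u = ?v \<longleftrightarrow> i = j"
      using ij idx_inj[OF idx] by auto
    have "?u + ?v + (idx i + idx j) = 2 * (d + 3)"
      using ij by auto
    then have "even (?u + ?v) \<longleftrightarrow> even (idx i + idx j)"
      by presburger
    then have sign: "(- 1 :: rat) ^ (?u + ?v) = (if even (idx i + idx j) then 1 else - 1)"
      by (simp only: minus_one_power_iff)
    show ?thesis
      unfolding laplacian_matrix_def ordered_facet_def vec_lambda_beta laplacian_facets[OF uv \<open>0 < d\<close>] eq sign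
      by (auto simp: s_def of_rat_add)
  qed
  have "columns (laplacian_matrix idx d)
    = range (\<lambda>j. real (d + 2) *\<^sub>R axis j 1 - (if j \<in> {j. even (idx j)} then s else - s))"
    unfolding columns_def full_SetCompr_eq[symmetric] column_def
    by (intro Collect_cong ex_cong1) (auto simp: vec_eq_iff entry s_def axis_def)
  then show ?thesis
    by (simp add: laplacian_polytope_def)
qed

text \<open>The complex consists of two points and the chain complex is not augmented: there are
  neither edges nor faces of dimension -1, so both sums in the Laplacian are empty.\<close>

lemma laplacian_polytope_0:
  fixes idx :: "'n::finite \<Rightarrow> nat"
  shows "laplacian_polytope idx 0 = {0}"
proof -
  have "faces (boundary_simplex 0) (- 1) = {}"
    by (simp add: faces_def)
  then have "laplacian_matrix idx 0 = 0"
    using faces_above_dim[of 0] by (simp add: laplacian_matrix_def laplacian_def vec_eq_iff)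
  then have "columns (laplacian_matrix idx 0) = {0}"
    by (auto simp: columns_def column_def vec_eq_iff)
  then show ?thesis
    by (simp add: laplacian_polytope_def)
qed

section \<open>From the configurations to the polytope\<close>

lemma unimodular_height_origin: "unimodular_height N {0} (\<lambda>_. 0)"
proof -
  have "primitive X" if "X \<subseteq> {0}" for X :: "(real ^ 'a::finite) set"
    using that by (auto simp: primitive_def subset_singleton_iff)
  then show ?thesis
    by (auto simp: unimodular_height_def exchange_minimal_def integer_points_def)
qed

text \<open>Half of \<open>x + y\<close> is a midpoint in the hull, and the choice
  \<open>x = y\<close> reaches every doubled point.\<close>

lemma convex_hull_doubled:
  fixes A :: "'a::real_vector set"
  shows "convex hull {v + x + y | x y. x \<in> A \<and> y \<in> A} = (\<lambda>x. v + 2 *\<^sub>R x) ` (convex hull A)"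
proof (intro antisym hull_minimal)
  show "{v + x + y | x y. x \<in> A \<and> y \<in> A} \<subseteq> (\<lambda>x. v + 2 *\<^sub>R x) ` (convex hull A)"
  proof clarify
    fix x y assume "x \<in> A" "y \<in> A"
    then have "(1 / 2) *\<^sub>R x + (1 / 2) *\<^sub>R y \<in> convex hull A"
      by (intro convexD convex_convex_hull) (auto simp: hull_inc)
    then show "v + x + y \<in> (\<lambda>x. v + 2 *\<^sub>R x) ` (convex hull A)"
      by (rule rev_image_eqI) (simp add: scaleR_add_right)
  qed
  show "convex ((\<lambda>x. v + 2 *\<^sub>R x) ` (convex hull A))"
    by (simp flip: convex_hull_affinity)
  show "(\<lambda>x. v + 2 *\<^sub>R x) ` (convex hull A) \<subseteq> convex hull {v + x + y | x y. x \<in> A \<and> y \<in> A}"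
    unfolding convex_hull_affinity[symmetric] by (intro hull_mono) (force simp: scaleR_2)
qed

lemma card_even_upto: "card {k \<in> {1..n}. even k} = n div 2"
proof (induction n)
  case (Suc n)
  have "{k \<in> {1..Suc n}. even k} = (if even (Suc n) then insert (Suc n) {k \<in> {1..n}. even k} else {k \<in> {1..n}. even k})"
    by (auto simp: le_Suc_eq)
  then show ?case
    using Suc by (auto simp: card_insert_if)
qed simp

theorem theoremA:
  fixes d :: nat and idx :: "'n::finite \<Rightarrow> nat"
  assumes "bij_betw idx UNIV {1..d + 2}"
  shows "\<exists>\<T>. lattice_triangulation \<T> (laplacian_polytope idx d) \<and>
              unimodular \<T> (laplacian_polytope idx d) \<and> regular \<T>"
proof (cases "d = 0")
  case True
  then show ?thesis
    using unimodular_height_triangulation[OF unimodular_height_origin] laplacian_polytope_0[of idx] by simp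
next
  case False
  define I where "I = {j. even (idx j)}"
  define s :: "real ^ 'n" where "s = (\<chi> j. if j \<in> I then 1 else - 1)"
  have P: "laplacian_polytope idx d
      = convex hull range (\<lambda>j. real (d + 2) *\<^sub>R axis j 1 - (if j \<in> I then s else - s))"
    unfolding s_def I_def using False by (intro laplacian_polytope_eq[OF assms]) simp
  have "bij_betw idx I {k \<in> {1..d + 2}. even k}"
    by (rule bij_betw_subset[OF assms]) (use bij_betw_imp_surj_on[OF assms] in \<open>auto simp: I_def\<close>)
  then have card_I: "card I = (d + 2) div 2"
    using card_even_upto[of "d + 2"] by (simp add: bij_betw_same_card)
  have "card (UNIV :: 'n set) = d + 2"
    using bij_betw_same_card[OF assms] by simp
  then have card_compl: "card (- I) = d + 2 - (d + 2) div 2"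
    using card_I by (simp add: Compl_eq_Diff_UNIV card_Diff_subset)
  show ?thesis
  proof (cases "odd d")
    case True
    have dim: "0 < d + 2"
      by simp
    have "unimodular_height 2 (join_config I (d + 2) s (- s)) (join_height idx (d + 2) I (d + 2) (- s) 0)"
      using True card_I by (intro unimodular_join_height_odd[OF assms s_def]) (auto elim: oddE)
    from unimodular_height_triangulation[OF this] show ?thesis
      unfolding P convex_hull_join_config[OF assms dim] .
  next
    case False
    then obtain m where m: "d = 2 * m"
      by (metis evenE)
    define q where "q = m + 1"
    define \<sigma> :: "real ^ 'n" where "\<sigma> = (\<chi> j. if j \<in> I then 1 else 0)"
    define \<tau> :: "real ^ 'n" where "\<tau> = (\<chi> j. if j \<in> I then 0 else 1)"
    define v :: "real ^ 'n" where "v = (\<chi> j. 1)"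
    have "0 < q" "card I = q" "card (- I) = q"
      using card_I card_compl m by (simp_all add: q_def)
    then obtain N \<omega> where "2 \<le> N" "unimodular_height N (join_config I q \<sigma> \<tau>) \<omega>"
      unfolding \<sigma>_def \<tau>_def using unimodular_join_height_even[OF assms] by blast
    moreover have "v \<in> integer_points"
      by (simp add: v_def integer_points_def)
    ultimately obtain \<omega>' where \<omega>':
      "unimodular_height N {v + x + y | x y. x \<in> join_config I q \<sigma> \<tau> \<and> y \<in> join_config I q \<sigma> \<tau>} \<omega>'"
      using unimodular_height_double by blast
    have "convex hull {v + x + y | x y. x \<in> join_config I q \<sigma> \<tau> \<and> y \<in> join_config I q \<sigma> \<tau>}
      = (\<lambda>x. v + 2 *\<^sub>R x) ` (convex hull range (\<lambda>j. real q *\<^sub>R axis j 1 - (if j \<in> I then \<sigma> else \<tau>)))"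
      unfolding convex_hull_doubled convex_hull_join_config[OF assms \<open>0 < q\<close>] ..
    also have "\<dots> = convex hull range (\<lambda>j. v + 2 *\<^sub>R (real q *\<^sub>R axis j 1 - (if j \<in> I then \<sigma> else \<tau>)))"
      unfolding convex_hull_affinity[symmetric] image_image ..
    \<comment> \<open>Here \<open>2 * q = d + 2\<close>, and subtracting twice
      \<open>\<sigma>\<close> or twice \<open>\<tau>\<close> from the all-ones vector gives
      \<open>- s\<close> or \<open>s\<close>.\<close>
    also have "(\<lambda>j. v + 2 *\<^sub>R (real q *\<^sub>R axis j 1 - (if j \<in> I then \<sigma> else \<tau>)))
      = (\<lambda>j. real (d + 2) *\<^sub>R axis j 1 - (if j \<in> I then s else - s))"
      by (rule ext) (auto simp: vec_eq_iff v_def \<sigma>_def \<tau>_def s_def axis_def q_def m algebra_simps)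
    finally show ?thesis
      using unimodular_height_triangulation[OF \<omega>'] unfolding P by simp
  qed
qed

end
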